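(* For every cactus $G$, we have $\overrightarrow{\chi}_s(G)\le 3$, and this bound is tight, i.e., there exists a cactus $G$ with $\overrightarrow{\chi}_s(G)=3$.
   Context: All graphs are finite and simple. An orientation $D$ of a graph $G$ is a digraph obtained from $G$ by replacing each edge by exactly one of the two possible arcs with the same end-vertices; $A(D)$ denotes its arc set. Given an orientation $D$ of $G$ and a weight function $w\colon A(D)\to\mathbb{Z}_+$ (values are positive integers), the in-weight $w^-_D(v)$ of a vertex $v$ is the sum of the weights of the arcs directed towards $v$ (so it is $0$ if there are none). The pair $(D,w)$ is a semi-proper orientation of $G$ if $w^-_D(u)\neq w^-_D(v)$ for every edge $uv\in E(G)$. Let $\mu^-(D,w)=\max_{v\in V(G)}w^-_D(v)$. The semi-proper orientation number $\overrightarrow{\chi}_s(G)$ is the minimum of $\mu^-(D,w)$ over all semi-proper orientations $(D,w)$ of $G$. A cactus is an outerplanar graph in which every 2-connected component (block, i.e., maximal nonseparable subgraph) is either an edge or a cycle. *)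

theory Defs
  imports "HOL-Analysis.Analysis" "HOL-Library.Extended_Nat"
begin

text \<open>A graph is given by its vertex set and its set of edges, each edge being the two-element
  set of its end-vertices.\<close>

definition simple_graph :: "'a set \<Rightarrow> 'a set set \<Rightarrow> bool" where
  "simple_graph V E \<longleftrightarrow> finite V \<and> V \<noteq> {} \<and> (\<forall>e\<in>E. e \<subseteq> V \<and> card e = 2)"

definition subgraph :: "'a set \<Rightarrow> 'a set set \<Rightarrow> 'a set \<Rightarrow> 'a set set \<Rightarrow> bool" where
  "subgraph W F V E \<longleftrightarrow> simple_graph W F \<and> W \<subseteq> V \<and> F \<subseteq> E"

definition graph_connected :: "'a set \<Rightarrow> 'a set set \<Rightarrow> bool" where
  "graph_connected V E \<longleftrightarrow> (\<forall>u\<in>V. \<forall>v\<in>V. (u, v) \<in> {(x, y). {x, y} \<in> E}\<^sup>*)"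


subsection \<open>Semi-proper orientations\<close>

text \<open>Each arc \<open>(u, v)\<close>, directed towards \<open>v\<close>, lies over the edge \<open>{u, v}\<close>; the bijection says
  that exactly one of the two possible arcs is chosen for every edge.\<close>

definition orientation :: "'a set set \<Rightarrow> ('a \<times> 'a) set \<Rightarrow> bool" where
  "orientation E A \<longleftrightarrow> bij_betw (\<lambda>(u, v). {u, v}) A E"

definition in_weight :: "('a \<times> 'a) set \<Rightarrow> ('a \<times> 'a \<Rightarrow> nat) \<Rightarrow> 'a \<Rightarrow> nat" where
  "in_weight A w v = (\<Sum>a\<in>{a \<in> A. snd a = v}. w a)"

definition semi_proper_orientation ::
    "'a set set \<Rightarrow> ('a \<times> 'a) set \<Rightarrow> ('a \<times> 'a \<Rightarrow> nat) \<Rightarrow> bool" where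
  "semi_proper_orientation E A w \<longleftrightarrow>
     orientation E A \<and> (\<forall>a\<in>A. w a > 0) \<and>
     (\<forall>u v. {u, v} \<in> E \<longrightarrow> in_weight A w u \<noteq> in_weight A w v)"

definition max_in_weight :: "'a set \<Rightarrow> ('a \<times> 'a) set \<Rightarrow> ('a \<times> 'a \<Rightarrow> nat) \<Rightarrow> nat" where
  "max_in_weight V A w = Max (in_weight A w ` V)"

text \<open>The values lie in \<^typ>\<open>enat\<close>, so that an infimum over a nonempty set is attained, while the
  infimum over the empty set is \<open>\<infinity>\<close>. Hence a finite upper bound always includes the existence
  of a semi-proper orientation attaining it.\<close>

definition semi_proper_orientation_number :: "'a set \<Rightarrow> 'a set set \<Rightarrow> enat" where
  "semi_proper_orientation_number V E =
     (INF (A, w)\<in>{(A, w). semi_proper_orientation E A w}. enat (max_in_weight V A w))"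


subsection \<open>Cacti\<close>

text \<open>For connected graphs a cut-vertex is a vertex whose removal leaves a disconnected graph.
  The graph with no vertices counts as connected here, so a single vertex is nonseparable.\<close>

definition nonseparable :: "'a set \<Rightarrow> 'a set set \<Rightarrow> bool" where
  "nonseparable V E \<longleftrightarrow>
     graph_connected V E \<and> (\<forall>v\<in>V. graph_connected (V - {v}) {e \<in> E. v \<notin> e})"

definition is_block :: "'a set \<Rightarrow> 'a set set \<Rightarrow> 'a set \<Rightarrow> 'a set set \<Rightarrow> bool" where
  "is_block B F V E \<longleftrightarrow>
     subgraph B F V E \<and> nonseparable B F \<and>
     (\<forall>B' F'. subgraph B' F' V E \<and> nonseparable B' F' \<and> B \<subseteq> B' \<and> F \<subseteq> F' \<longrightarrow> B' = B \<and> F' = F)"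

definition is_edge_graph :: "'a set \<Rightarrow> 'a set set \<Rightarrow> bool" where
  "is_edge_graph V E \<longleftrightarrow> (\<exists>u v. u \<noteq> v \<and> V = {u, v} \<and> E = {{u, v}})"

definition is_cycle_graph :: "'a set \<Rightarrow> 'a set set \<Rightarrow> bool" where
  "is_cycle_graph V E \<longleftrightarrow>
     (\<exists>xs. distinct xs \<and> length xs \<ge> 3 \<and> V = set xs \<and>
           E = {{xs ! i, xs ! (Suc i mod length xs)} | i. i < length xs})"

text \<open>A planar drawing sends vertices to distinct points and edges to simple arcs joining their
  end-vertices, where an arc meets vertices and other arcs only at common end-vertices.\<close>

definition planar_drawing ::
    "'a set \<Rightarrow> 'a set set \<Rightarrow> ('a \<Rightarrow> complex) \<Rightarrow> ('a set \<Rightarrow> real \<Rightarrow> complex) \<Rightarrow> bool" where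
  "planar_drawing V E p \<gamma> \<longleftrightarrow>
     inj_on p V \<and>
     (\<forall>e\<in>E. arc (\<gamma> e) \<and> {pathstart (\<gamma> e), pathfinish (\<gamma> e)} = p ` e \<and>
             path_image (\<gamma> e) \<inter> p ` V = p ` e) \<and>
     (\<forall>e\<in>E. \<forall>f\<in>E. e \<noteq> f \<longrightarrow> path_image (\<gamma> e) \<inter> path_image (\<gamma> f) \<subseteq> p ` (e \<inter> f))"

text \<open>The set \<open>outside S\<close> is the union of the unbounded components of the complement of \<open>S\<close>; for
  the compact point set \<open>S\<close> of a drawing it is the outer face.\<close>

definition outerplanar :: "'a set \<Rightarrow> 'a set set \<Rightarrow> bool" where
  "outerplanar V E \<longleftrightarrow>
     (\<exists>p \<gamma>. planar_drawing V E p \<gamma> \<and>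
            p ` V \<subseteq> frontier (outside (p ` V \<union> (\<Union>e\<in>E. path_image (\<gamma> e)))))"

text \<open>The only blocks without edges are isolated vertices. They are not 2-connected components in
  any substantial sense and are permitted, so that for instance the one-vertex graph is a
  cactus. A cactus need not be connected.\<close>

definition cactus :: "'a set \<Rightarrow> 'a set set \<Rightarrow> bool" where
  "cactus V E \<longleftrightarrow>
     simple_graph V E \<and> outerplanar V E \<and>
     (\<forall>B F. is_block B F V E \<and> F \<noteq> {} \<longrightarrow> is_edge_graph B F \<or> is_cycle_graph B F)"

end

theory Submission
  imports Defs
begin

text \<open>Upper bound: the graph is oriented block by block, moving away from a root. If \<open>W\<close> is the set
  of vertices treated so far and no path through the complement of \<open>W\<close> joins two vertices of \<open>W\<close>,
  then a block containing an edge that leaves \<open>W\<close> meets \<open>W\<close> in a single vertex \<open>v\<close>. Its edges can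
  be oriented without arcs into \<open>v\<close>, so the in-weight of \<open>v\<close> does not change and the in-weights
  of the other vertices of the block can be chosen independently of the rest: this is a colouring
  of an edge or a cycle by \<open>1, 2, 3\<close> with one prescribed colour at \<open>v\<close>. Sharpness: two disjoint
  triangles joined by an edge.\<close>

text \<open>The condition on \<open>W\<close> survives the addition of a block because blocks
  satisfy it themselves: a path outside a block between two of its vertices would be an ear, and
  adding an ear preserves nonseparability, against maximality. The number 3 comes from colouring a
  path with both end colours fixed: one interior vertex has two coloured neighbours to avoid. In the
  lower bound, one triangle is not enough: its in-weights 0, 1, 2 add up to 3, its number of edges.
  Two triangles allow 6 in total, and the joining edge is the seventh arc.\<close>

section \<open>Reachability along edges, and ears\<close>

definition adj :: "'a set set \<Rightarrow> ('a \<times> 'a) set" where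
  "adj E = {(x, y). {x, y} \<in> E}"

lemma adj_sym_rtrancl: "(x, y) \<in> (adj E)\<^sup>* \<Longrightarrow> (y, x) \<in> (adj E)\<^sup>*"
proof -
  have "sym (adj E)" by (auto simp: sym_def adj_def insert_commute)
  then show "(x, y) \<in> (adj E)\<^sup>* \<Longrightarrow> (y, x) \<in> (adj E)\<^sup>*"
    using sym_rtrancl symD by metis
qed

lemma adj_rtrancl_mono: "(x, y) \<in> (adj E)\<^sup>* \<Longrightarrow> E \<subseteq> F \<Longrightarrow> (x, y) \<in> (adj F)\<^sup>*"
  by (rule subsetD[OF rtrancl_mono]) (auto simp: adj_def)

lemma adj_rtrancl_edge: "{x, y} \<in> E \<Longrightarrow> (x, y) \<in> (adj E)\<^sup>*"
  by (auto simp: adj_def)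

lemma graph_connected_adj:
  "graph_connected V E \<longleftrightarrow> (\<forall>u\<in>V. \<forall>v\<in>V. (u, v) \<in> (adj E)\<^sup>*)"
  by (simp add: graph_connected_def adj_def)

lemma graph_connectedI:
  assumes "\<And>u. u \<in> V \<Longrightarrow> (u, c) \<in> (adj E)\<^sup>*"
  shows "graph_connected V E"
  unfolding graph_connected_adj
proof (intro ballI)
  fix u v assume "u \<in> V" "v \<in> V"
  then have "(u, c) \<in> (adj E)\<^sup>*" "(c, v) \<in> (adj E)\<^sup>*"
    using assms adj_sym_rtrancl by metis+
  then show "(u, v) \<in> (adj E)\<^sup>*" by (rule rtrancl_trans)
qed

lemma graph_connectedD:
  "graph_connected V E \<Longrightarrow> u \<in> V \<Longrightarrow> v \<in> V \<Longrightarrow> (u, v) \<in> (adj E)\<^sup>*"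
  by (simp add: graph_connected_adj)

lemma adj_rtrancl_segment:
  assumes "\<And>i. lo \<le> i \<Longrightarrow> i < hi \<Longrightarrow> {f i, f (Suc i)} \<in> F" and "lo \<le> i" "i \<le> hi"
  shows "(f lo, f i) \<in> (adj F)\<^sup>*"
  using assms(2,3)
proof (induction i rule: dec_induct)
  case base
  then show ?case by simp
next
  case (step n)
  then have "{f n, f (Suc n)} \<in> F" using assms(1) by simp
  then have "(f n, f (Suc n)) \<in> adj F" by (simp add: adj_def)
  then show ?case using step rtrancl_into_rtrancl by (metis Suc_leD)
qed

lemma adj_rtrancl_invariant:
  assumes "(x, y) \<in> (adj F)\<^sup>*" and "x \<in> S"
    and "\<And>a b. {a, b} \<in> F \<Longrightarrow> a \<in> S \<Longrightarrow> b \<in> S"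
  shows "y \<in> S"
  using assms(1,2) by (induction rule: rtrancl_induct) (auto simp: adj_def intro: assms(3))

text \<open>The \<open>f i\<close> are the interior of an ear from \<open>a\<close> to
  \<open>b\<close>; \<open>n = 0\<close> is a detour over one vertex. Deleting a vertex of
  \<open>B\<close> destroys at most one of the two attachments, since \<open>a\<close> and
  \<open>b\<close> differ, and leaves the ear in one piece. Deleting \<open>f k\<close> splits the
  ear into a piece attached to \<open>a\<close> and one attached to \<open>b\<close>, while all of
  \<open>F\<close> remains.\<close>

lemma nonseparable_ear:
  fixes f :: "nat \<Rightarrow> 'a"
  assumes ns: "nonseparable B F" and F: "\<And>e. e \<in> F \<Longrightarrow> e \<subseteq> B"
    and ab: "a \<in> B" "b \<in> B" "a \<noteq> b"
    and fB: "\<And>i. i \<le> n \<Longrightarrow> f i \<notin> B" and inj: "inj_on f {..n}"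
    and G: "G = F \<union> {{a, f 0}, {f n, b}} \<union> (\<lambda>i. {f i, f (Suc i)}) ` {..<n}"
  shows "nonseparable (B \<union> f ` {..n}) G"
proof -
  have FG: "F \<subseteq> G" and eG: "{a, f 0} \<in> G" "{f n, b} \<in> G"
    and sG: "\<And>i. i < n \<Longrightarrow> {f i, f (Suc i)} \<in> G"
    by (auto simp: G)
  have conn: "graph_connected B F" and connv: "\<And>v. v \<in> B \<Longrightarrow> graph_connected (B - {v}) {e \<in> F. v \<notin> e}"
    using ns by (auto simp: nonseparable_def)
  have whole: "graph_connected (B \<union> f ` {..n}) G"
  proof (rule graph_connectedI[where c = a])
    fix u assume "u \<in> B \<union> f ` {..n}"
    then consider "u \<in> B" | i where "i \<le> n" "u = f i" by auto
    then show "(u, a) \<in> (adj G)\<^sup>*"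
    proof cases
      case 1
      then show ?thesis using graph_connectedD[OF conn _ ab(1)] FG adj_rtrancl_mono by metis
    next
      case 2
      have "(f 0, f i) \<in> (adj G)\<^sup>*"
        by (rule adj_rtrancl_segment[where hi = n]) (use 2 sG in auto)
      then have "(f i, f 0) \<in> (adj G)\<^sup>*" by (rule adj_sym_rtrancl)
      moreover have "(f 0, a) \<in> (adj G)\<^sup>*" using eG(1) adj_rtrancl_edge adj_sym_rtrancl by metis
      ultimately have "(f i, a) \<in> (adj G)\<^sup>*" by (rule rtrancl_trans)
      then show ?thesis using 2 by simp
    qed
  qed
  have "graph_connected (B \<union> f ` {..n} - {w}) {e \<in> G. w \<notin> e}" if w: "w \<in> B" for w
  proof -
    let ?H = "{e \<in> G. w \<notin> e}"
    have wf: "\<And>i. i \<le> n \<Longrightarrow> w \<noteq> f i" using w fB by auto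
    have sub: "{e \<in> F. w \<notin> e} \<subseteq> ?H" using FG by auto
    have sH: "\<And>i. i < n \<Longrightarrow> {f i, f (Suc i)} \<in> ?H" using sG wf by auto
    have seg: "(f 0, f i) \<in> (adj ?H)\<^sup>*" if "i \<le> n" for i
      by (rule adj_rtrancl_segment[where hi = n]) (use that sH in auto)
    obtain c where c: "c \<in> B - {w}" "(f 0, c) \<in> (adj ?H)\<^sup>*"
    proof (cases "w = a")
      case True
      then have "{f n, b} \<in> ?H" using eG(2) wf ab by auto
      then have "(f 0, b) \<in> (adj ?H)\<^sup>*" 
        using rtrancl_trans[OF seg[of n] adj_rtrancl_edge] by simp
      then show ?thesis using that True ab by auto
    next
      case False
      then have "{a, f 0} \<in> ?H" using eG(1) wf ab by auto
      then have "(f 0, a) \<in> (adj ?H)\<^sup>*" using adj_rtrancl_edge adj_sym_rtrancl by metis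
      then show ?thesis using that False ab by auto
    qed
    show ?thesis
    proof (rule graph_connectedI[where c = c])
      fix u assume "u \<in> B \<union> f ` {..n} - {w}"
      then consider "u \<in> B - {w}" | i where "i \<le> n" "u = f i" by auto
      then show "(u, c) \<in> (adj ?H)\<^sup>*"
      proof cases
        case 1
        then show ?thesis using graph_connectedD[OF connv[OF w] _ c(1)] sub adj_rtrancl_mono by metis
      next
        case 2
        then show ?thesis using rtrancl_trans[OF adj_sym_rtrancl[OF seg[of i]] c(2)] by simp
      qed
    qed
  qed
  moreover have "graph_connected (B \<union> f ` {..n} - {f k}) {e \<in> G. f k \<notin> e}" if k: "k \<le> n" for k
  proof -
    let ?H = "{e \<in> G. f k \<notin> e}"
    have fk: "f i \<noteq> f k" if "i \<le> n" "i \<noteq> k" for i using that k inj by (auto simp: inj_on_def)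
    have sub: "F \<subseteq> ?H" using FG F fB k by auto
    have kab: "f k \<noteq> a" "f k \<noteq> b" using fB[OF k] ab by auto
    show ?thesis
    proof (rule graph_connectedI[where c = a])
      fix u assume "u \<in> B \<union> f ` {..n} - {f k}"
      then consider "u \<in> B" | i where "i < k" "u = f i" | i where "k < i" "i \<le> n" "u = f i"
        by auto (metis linorder_neqE_nat)
      then show "(u, a) \<in> (adj ?H)\<^sup>*"
      proof cases
        case 1
        then show ?thesis using graph_connectedD[OF conn _ ab(1)] sub adj_rtrancl_mono by metis
      next
        case 2
        \<comment> \<open>The edge from \<open>f (k - 1)\<close> to \<open>f k\<close> is deleted,
          hence the bound \<open>k - 1\<close>; in this case \<open>k\<close> is positive, so the
          subtraction is exact.\<close>
        have sH: "{f i, f (Suc i)} \<in> ?H" if "i < k - 1" for i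
        proof -
          have "i < n" "i \<noteq> k" "Suc i \<noteq> k" using that k by linarith+
          then show ?thesis using sG[of i] fk[of i] fk[of "Suc i"] by auto
        qed
        have "(f 0, f i) \<in> (adj ?H)\<^sup>*"
          by (rule adj_rtrancl_segment[where hi = "k - 1"]) (use 2 sH in auto)
        then have "(f i, f 0) \<in> (adj ?H)\<^sup>*" by (rule adj_sym_rtrancl)
        moreover have "{a, f 0} \<in> ?H" using eG(1) fk[of 0] kab 2 by auto
        then have "(f 0, a) \<in> (adj ?H)\<^sup>*" using adj_rtrancl_edge adj_sym_rtrancl by metis
        ultimately have "(f i, a) \<in> (adj ?H)\<^sup>*" by (rule rtrancl_trans)
        then show ?thesis using 2 by simp
      next
        case 3
        have sH: "{f j, f (Suc j)} \<in> ?H" if "i \<le> j" "j < n" for j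
        proof -
          have "j < n" "j \<noteq> k" "Suc j \<noteq> k" using that 3 by linarith+
          then show ?thesis using sG[of j] fk[of j] fk[of "Suc j"] by auto
        qed
        have "(f i, f n) \<in> (adj ?H)\<^sup>*"
          by (rule adj_rtrancl_segment[where hi = n]) (use 3 sH in auto)
        moreover have "{f n, b} \<in> ?H" using eG(2) fk[of n] kab 3 by auto
        then have "(f n, b) \<in> (adj ?H)\<^sup>*" by (rule adj_rtrancl_edge)
        moreover have "(b, a) \<in> (adj ?H)\<^sup>*"
          using graph_connectedD[OF conn ab(2,1)] sub adj_rtrancl_mono by metis
        ultimately have "(f i, a) \<in> (adj ?H)\<^sup>*" using rtrancl_trans[OF rtrancl_trans] by meson
        then show ?thesis using 3 by simp
      qed
    qed
  qed
  ultimately show ?thesis using whole by (auto simp: nonseparable_def)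
qed

section \<open>Blocks and paths through the complement of a vertex set\<close>

definition outer_adj :: "'a set set \<Rightarrow> 'a set \<Rightarrow> ('a \<times> 'a) set" where
  "outer_adj E W = {(x, y). {x, y} \<in> E \<and> x \<notin> W \<and> y \<notin> W}"

text \<open>No path of length at least two joins two different vertices of \<open>W\<close> through the
  complement of \<open>W\<close>.\<close>

definition path_closed :: "'a set set \<Rightarrow> 'a set \<Rightarrow> bool" where
  "path_closed E W \<longleftrightarrow>
     (\<forall>u\<in>W. \<forall>v\<in>W. \<forall>x y. x \<notin> W \<and> y \<notin> W \<and> {u, x} \<in> E \<and> {y, v} \<in> E \<and>
        (x, y) \<in> (outer_adj E W)\<^sup>* \<longrightarrow> u = v)"

text \<open>A walk with the fewest steps works: if \<open>f i = f j\<close> with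
  \<open>i < j\<close>, leaving out the part in between would give a shorter one.\<close>

lemma rtrancl_injective_path:
  fixes R :: "('a \<times> 'a) set"
  assumes "(x, y) \<in> R\<^sup>*"
  obtains f :: "nat \<Rightarrow> 'a" and n where "f 0 = x" "f n = y"
    "\<And>i. i < n \<Longrightarrow> (f i, f (Suc i)) \<in> R" "inj_on f {..n}"
proof -
  define n where "n = (LEAST n. (x, y) \<in> R ^^ n)"
  have "\<exists>n. (x, y) \<in> R ^^ n" using assms rtrancl_power by metis
  then have n: "(x, y) \<in> R ^^ n" unfolding n_def by (rule LeastI_ex)
  then obtain f where f: "f 0 = x" "f n = y" "\<And>i. i < n \<Longrightarrow> (f i, f (Suc i)) \<in> R"
    using relpow_fun_conv by metis
  have "f i \<noteq> f j" if ij: "i < j" "j \<le> n" for i j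
  proof
    assume eq: "f i = f j"
    have "(f 0, f i) \<in> R ^^ i"
      unfolding relpow_fun_conv by (rule exI[of _ f]) (use f ij in auto)
    moreover have "(f j, f n) \<in> R ^^ (n - j)"
      unfolding relpow_fun_conv by (rule exI[of _ "\<lambda>l. f (j + l)"]) (use f ij in auto)
    ultimately have "(x, y) \<in> R ^^ (i + (n - j))"
      using eq f by (auto simp: relpow_add)
    then have "n \<le> i + (n - j)" unfolding n_def by (rule Least_le)
    then show False using ij by simp
  qed
  then have "inj_on f {..n}" by (auto simp: inj_on_def) (metis linorder_neqE_nat)
  then show ?thesis using that f by blast
qed

text \<open>A path outside \<open>B\<close> between two different vertices of \<open>B\<close>, made
  injective, is an ear. Adding it gives a nonseparable subgraph with the new vertex
  \<open>x\<close>, which contradicts the maximality of the block.\<close>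

lemma block_path_closed:
  assumes G: "simple_graph V E" and blk: "is_block B F V E"
  shows "path_closed E B"
  unfolding path_closed_def
proof (intro ballI allI impI, elim conjE, rule ccontr)
  fix a b x y
  assume ab: "a \<in> B" "b \<in> B" and xy: "x \<notin> B" "y \<notin> B" and e: "{a, x} \<in> E" "{y, b} \<in> E"
    and path: "(x, y) \<in> (outer_adj E B)\<^sup>*" and ne: "a \<noteq> b"
  obtain f :: "nat \<Rightarrow> 'a" and n where f: "f 0 = x" "f n = y"
    "\<And>i. i < n \<Longrightarrow> (f i, f (Suc i)) \<in> outer_adj E B" "inj_on f {..n}"
    using rtrancl_injective_path[OF path] by metis
  have fB: "f i \<notin> B" if "i \<le> n" for i
    using that f(2) f(3)[of i] xy by (cases "i = n") (auto simp: outer_adj_def)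
  have fE: "{f i, f (Suc i)} \<in> E" if "i < n" for i
    using f(3)[OF that] by (simp add: outer_adj_def)
  define F' where "F' = F \<union> {{a, f 0}, {f n, b}} \<union> (\<lambda>i. {f i, f (Suc i)}) ` {..<n}"
  have sub: "subgraph B F V E" and ns: "nonseparable B F"
    and mx: "\<And>B' F'. subgraph B' F' V E \<Longrightarrow> nonseparable B' F' \<Longrightarrow> B \<subseteq> B' \<Longrightarrow> F \<subseteq> F' \<Longrightarrow> B' = B \<and> F' = F"
    using blk by (auto simp: is_block_def)
  have FB: "\<And>e. e \<in> F \<Longrightarrow> e \<subseteq> B" using sub by (auto simp: subgraph_def simple_graph_def)
  have ns': "nonseparable (B \<union> f ` {..n}) F'"
    by (rule nonseparable_ear[OF ns FB ab ne fB f(4) F'_def])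
  have F'E: "F' \<subseteq> E" using sub e f(1,2) fE by (auto simp: F'_def subgraph_def)
  have F'B: "\<And>e. e \<in> F' \<Longrightarrow> e \<subseteq> B \<union> f ` {..n}"
    unfolding F'_def using FB ab by fastforce
  have EV: "\<And>e. e \<in> E \<Longrightarrow> e \<subseteq> V \<and> card e = 2" using G by (auto simp: simple_graph_def)
  have "f i \<in> V" if "i \<le> n" for i
    using that f(2) EV[OF e(2)] EV[OF fE[of i]] by (cases "i = n") auto
  then have "subgraph (B \<union> f ` {..n}) F' V E"
    using sub F'E F'B EV by (auto simp: subgraph_def simple_graph_def)
  then have "B \<union> f ` {..n} = B" using mx[OF _ ns'] F'_def by blast
  then show False using fB[of 0] by auto
qed

lemma nonseparable_edge: "nonseparable {u, v} {{u, v}}"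
proof -
  have "(u, v) \<in> (adj {{u, v}})\<^sup>*" by (rule adj_rtrancl_edge) simp
  then have "graph_connected {u, v} {{u, v}}"
    by (intro graph_connectedI[where c = v]) auto
  moreover have "graph_connected ({u, v} - {w}) H" if "w \<in> {u, v}" for w and H :: "'a set set"
    using that by (auto simp: graph_connected_adj)
  ultimately show ?thesis by (auto simp: nonseparable_def)
qed

lemma ex_block_of_nonseparable:
  assumes G: "simple_graph V E" and sub: "subgraph B0 F0 V E" and ns: "nonseparable B0 F0"
  obtains B F where "is_block B F V E" "B0 \<subseteq> B" "F0 \<subseteq> F"
proof -
  let ?S = "{(B, F). subgraph B F V E \<and> nonseparable B F \<and> B0 \<subseteq> B \<and> F0 \<subseteq> F}"
  have "finite V" using G by (simp add: simple_graph_def)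
  moreover have "E \<subseteq> Pow V" using G by (auto simp: simple_graph_def)
  ultimately have fin: "finite V" "finite E" using finite_subset by blast+
  have bound: "card (fst K') + card (snd K') \<le> card V + card E" if "K' \<in> ?S" for K'
  proof -
    have "fst K' \<subseteq> V" "snd K' \<subseteq> E" using that by (auto simp: subgraph_def)
    then show ?thesis using fin by (intro add_mono card_mono)
  qed
  have "(B0, F0) \<in> ?S" using sub ns by simp
  then have "\<exists>K. K \<in> ?S \<and> (\<forall>K'. K' \<in> ?S \<longrightarrow> card (fst K') + card (snd K') \<le> card (fst K) + card (snd K))"
    by (rule ex_has_greatest_nat[where b = "Suc (card V + card E)"]) (use bound in \<open>simp only: less_Suc_eq_le, blast\<close>)
  then obtain K where K: "K \<in> ?S" and
    mx: "\<And>K'. K' \<in> ?S \<Longrightarrow> card (fst K') + card (snd K') \<le> card (fst K) + card (snd K)"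
    by blast
  obtain B F where BF: "K = (B, F)" by force
  have "B' = B \<and> F' = F" if "subgraph B' F' V E" "nonseparable B' F'" "B \<subseteq> B'" "F \<subseteq> F'" for B' F'
  proof -
    have "(B', F') \<in> ?S" using that K BF by auto
    from mx[OF this] have le: "card B' + card F' \<le> card B + card F" using BF by simp
    have "finite B'" "finite F'" using that(1) fin finite_subset by (auto simp: subgraph_def)
    then have "card B = card B'" "card F = card F'"
      using le card_mono[OF _ that(3)] card_mono[OF _ that(4)] by linarith+
    then show ?thesis
      using card_subset_eq[OF _ that(3)] card_subset_eq[OF _ that(4)] \<open>finite B'\<close> \<open>finite F'\<close> by auto
  qed
  then have "is_block B F V E" using K BF unfolding is_block_def by blast
  then show ?thesis using that K BF by auto
qed

lemma is_blockD:
  assumes "is_block B F V E"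
  shows "subgraph B F V E" "nonseparable B F"
    "\<And>B' F'. subgraph B' F' V E \<Longrightarrow> nonseparable B' F' \<Longrightarrow> B \<subseteq> B' \<Longrightarrow> F \<subseteq> F' \<Longrightarrow> B' = B \<and> F' = F"
  using assms unfolding is_block_def by blast+

lemma simple_graph_edgeD:
  assumes "simple_graph V E" "e \<in> E"
  shows "e \<subseteq> V" "card e = 2"
  using assms unfolding simple_graph_def by blast+

text \<open>The walk is followed up to its first entry into \<open>W\<close>. This turns
  connectivity inside a block into paths to which \<open>path_closed\<close> applies.\<close>

lemma rtrancl_avoiding_or_first_hit:
  assumes "(x, y) \<in> (adj F)\<^sup>*" and "x \<notin> W"
  shows "(x, y) \<in> (outer_adj F W)\<^sup>* \<and> y \<notin> W \<or>
    (\<exists>z u. (x, z) \<in> (outer_adj F W)\<^sup>* \<and> z \<notin> W \<and> {z, u} \<in> F \<and> u \<in> W)"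
  using assms(1)
proof (induction rule: rtrancl_induct)
  case base
  then show ?case using assms(2) by simp
next
  case (step y z)
  from step.IH show ?case
  proof
    assume y: "(x, y) \<in> (outer_adj F W)\<^sup>* \<and> y \<notin> W"
    have yz: "{y, z} \<in> F" using step.hyps by (simp add: adj_def)
    show ?case
    proof (cases "z \<in> W")
      case True
      then show ?thesis using y yz by metis
    next
      case False
      then have "(y, z) \<in> outer_adj F W" using y yz by (simp add: outer_adj_def)
      then have "(x, z) \<in> (outer_adj F W)\<^sup>*" using y rtrancl_into_rtrancl by metis
      then show ?thesis using False by metis
    qed
  next
    assume "\<exists>z u. (x, z) \<in> (outer_adj F W)\<^sup>* \<and> z \<notin> W \<and> {z, u} \<in> F \<and> u \<in> W"
    then show ?case by (rule disjI2)
  qed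
qed

lemma outer_adj_rtrancl_mono:
  "(x, y) \<in> (outer_adj F W)\<^sup>* \<Longrightarrow> F \<subseteq> E \<Longrightarrow> W' \<subseteq> W \<Longrightarrow> (x, y) \<in> (outer_adj E W')\<^sup>*"
  by (rule subsetD[OF rtrancl_mono]) (auto simp: outer_adj_def)

lemma outer_adj_rtrancl_sym: "(x, y) \<in> (outer_adj E W)\<^sup>* \<Longrightarrow> (y, x) \<in> (outer_adj E W)\<^sup>*"
proof -
  have "sym (outer_adj E W)" by (auto simp: sym_def outer_adj_def insert_commute)
  then show "(x, y) \<in> (outer_adj E W)\<^sup>* \<Longrightarrow> (y, x) \<in> (outer_adj E W)\<^sup>*"
    using sym_rtrancl symD by metis
qed

lemma path_closedD:
  "path_closed E W \<Longrightarrow> u \<in> W \<Longrightarrow> v \<in> W \<Longrightarrow> x \<notin> W \<Longrightarrow> y \<notin> W \<Longrightarrow> {u, x} \<in> E \<Longrightarrow> {y, v} \<in> E \<Longrightarrow>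
    (x, y) \<in> (outer_adj E W)\<^sup>* \<Longrightarrow> u = v"
  unfolding path_closed_def by blast

context
  fixes V E W B F v x
  assumes G: "simple_graph V E" and W: "path_closed E W" and blk: "is_block B F V E"
    and vx: "v \<in> W" "x \<notin> W" "{v, x} \<in> E" "v \<in> B" "x \<in> B"
begin

text \<open>If \<open>B\<close> met \<open>W\<close> in a second vertex \<open>u\<close>, then
  \<open>x\<close> could still reach \<open>u\<close> in the block after the deletion of
  \<open>v\<close>. The first vertex \<open>t\<close> of \<open>W\<close> on the way differs from
  \<open>v\<close>, and \<open>v\<close> is joined to it over \<open>x\<close> by a path outside
  \<open>W\<close>, which \<open>path_closed\<close> excludes.\<close>

lemma block_Int_path_closed: "B \<inter> W = {v}"
proof -
  have FE: "F \<subseteq> E" and conn: "\<And>w. w \<in> B \<Longrightarrow> graph_connected (B - {w}) {e \<in> F. w \<notin> e}"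
    using blk by (auto simp: is_block_def subgraph_def nonseparable_def)
  have "u = v" if u: "u \<in> B" "u \<in> W" for u
  proof (rule ccontr)
    assume ne: "u \<noteq> v"
    let ?H = "{e \<in> F. v \<notin> e}"
    have "(x, u) \<in> (adj ?H)\<^sup>*" using graph_connectedD[OF conn[OF vx(4)], of x u] u vx ne by auto
    from rtrancl_avoiding_or_first_hit[OF this vx(2)] u(2)
    have "\<exists>z t. (x, z) \<in> (outer_adj ?H W)\<^sup>* \<and> z \<notin> W \<and> {z, t} \<in> ?H \<and> t \<in> W" by simp
    then obtain z t
      where zt: "(x, z) \<in> (outer_adj ?H W)\<^sup>*" "z \<notin> W" "{z, t} \<in> ?H" "t \<in> W" by (elim exE conjE)
    have "(x, z) \<in> (outer_adj E W)\<^sup>*" by (rule outer_adj_rtrancl_mono[OF zt(1)]) (use FE in auto)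
    then have "v = t" using path_closedD[OF W vx(1) zt(4) vx(2) zt(2) vx(3)] zt(3) FE by auto
    then show False using zt(3) by auto
  qed
  then show ?thesis using vx by blast
qed

text \<open>A walk from \<open>b\<close> to \<open>v\<close> inside the block can enter
  \<open>W\<close> only at \<open>v\<close>. With it, a path that ends in the block can be prolonged
  to one that ends in \<open>W\<close>.\<close>

lemma block_path_to_attachment:
  assumes b: "b \<in> B" "b \<noteq> v"
  shows "\<exists>z. (b, z) \<in> (outer_adj E W)\<^sup>* \<and> z \<notin> W \<and> {z, v} \<in> E"
proof -
  have FE: "F \<subseteq> E" and FB: "\<And>e. e \<in> F \<Longrightarrow> e \<subseteq> B" and conn: "graph_connected B F"
    using blk by (auto simp: is_block_def subgraph_def nonseparable_def simple_graph_def)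
  have bW: "b \<notin> W" using b block_Int_path_closed by auto
  have "(b, v) \<in> (adj F)\<^sup>*" by (rule graph_connectedD[OF conn b(1) vx(4)])
  from rtrancl_avoiding_or_first_hit[OF this bW] vx(1) obtain z t
    where zt: "(b, z) \<in> (outer_adj F W)\<^sup>*" "z \<notin> W" "{z, t} \<in> F" "t \<in> W" by metis
  have "t = v" using FB[OF zt(3)] zt(4) block_Int_path_closed by auto
  then show ?thesis using outer_adj_rtrancl_mono[OF zt(1) FE] zt FE by auto
qed

text \<open>Only a path from \<open>c\<close> in \<open>W\<close> to \<open>d\<close> in
  \<open>B\<close> is not covered by path-closedness of \<open>W\<close> or of \<open>B\<close>. It
  is continued from \<open>d\<close> to \<open>v\<close> by \<open>block_path_to_attachment\<close>
  and then joins two vertices of \<open>W\<close>, so \<open>c = v\<close>, which lies in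
  \<open>B\<close> as well.\<close>

lemma path_closed_Un_block: "path_closed E (W \<union> B)"
  unfolding path_closed_def
proof (intro ballI allI impI, elim conjE)
  fix a b y z
  assume ab: "a \<in> W \<union> B" "b \<in> W \<union> B" and yz: "y \<notin> W \<union> B" "z \<notin> W \<union> B"
    and e: "{a, y} \<in> E" "{z, b} \<in> E" and path: "(y, z) \<in> (outer_adj E (W \<union> B))\<^sup>*"
  have pW: "(y, z) \<in> (outer_adj E W)\<^sup>*" and pB: "(y, z) \<in> (outer_adj E B)\<^sup>*"
    using outer_adj_rtrancl_mono[OF path] by auto
  have mixed: "c = v" if c: "c \<in> W" and d: "d \<in> B" "d \<noteq> v" and st: "s \<notin> W" "t \<notin> W"
    and cs: "{c, s} \<in> E" and td: "{t, d} \<in> E" and p: "(s, t) \<in> (outer_adj E W)\<^sup>*" for c d s t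
  proof -
    obtain r where r: "(d, r) \<in> (outer_adj E W)\<^sup>*" "r \<notin> W" "{r, v} \<in> E"
      using block_path_to_attachment[OF d] by metis
    have "d \<notin> W" using d block_Int_path_closed by auto
    then have "(t, d) \<in> outer_adj E W" using st td by (simp add: outer_adj_def)
    then have "(s, d) \<in> (outer_adj E W)\<^sup>*" using p rtrancl_into_rtrancl by metis
    then have "(s, r) \<in> (outer_adj E W)\<^sup>*" using r(1) by (rule rtrancl_trans)
    then show ?thesis using path_closedD[OF W c vx(1) st(1) r(2) cs r(3)] by simp
  qed
  show "a = b"
  proof -
    consider "a \<in> W" "b \<in> W" | "a \<in> B" "b \<in> B" | "a \<in> W" "a \<notin> B" "b \<in> B" "b \<noteq> v" | "b \<in> W" "b \<notin> B" "a \<in> B" "a \<noteq> v"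
      using ab vx(1,4) by blast
    then show ?thesis
    proof cases
      case 1
      then show ?thesis using path_closedD[OF W _ _ _ _ e pW] yz by auto
    next
      case 2
      then show ?thesis using path_closedD[OF block_path_closed[OF G blk] _ _ _ _ e pB] yz by auto
    next
      case 3
      then have "a = v" using mixed[OF _ _ _ _ _ e pW] yz by auto
      then show ?thesis using 3 vx(4) by auto
    next
      case 4
      have "{b, z} \<in> E" "{y, a} \<in> E" using e by (auto simp: insert_commute)
      then have "b = v" using mixed[of b a z y] outer_adj_rtrancl_sym[OF pW] 4 yz by auto
      then show ?thesis using 4 vx(4) by auto
    qed
  qed
qed

text \<open>This shows that the graph induced on \<open>W \<union> B\<close> gains exactly the edges
  of \<open>F\<close>. One end \<open>b\<close> of \<open>e\<close> lies in \<open>B\<close> outside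
  \<open>W\<close>. If the other were not in \<open>B\<close>, it would be a vertex of
  \<open>W\<close> other than \<open>v\<close>, joined to \<open>v\<close> by a path over
  \<open>b\<close>. With both ends in \<open>B\<close>, adding \<open>e\<close> keeps the block
  nonseparable, so maximality puts \<open>e\<close> into \<open>F\<close>.\<close>

lemma edge_in_Un_block:
  assumes "e \<in> E" "e \<subseteq> W \<union> B" "\<not> e \<subseteq> W"
  shows "e \<in> F"
proof -
  note sub = is_blockD(1)[OF blk] and ns = is_blockD(2)[OF blk] and mx = is_blockD(3)[OF blk]
  have "card e = 2" using G assms(1) by (simp add: simple_graph_def)
  then obtain p q where pq: "e = {p, q}" "p \<noteq> q" by (meson card_2_iff)
  obtain a b where ab: "e = {a, b}" "b \<in> B" "b \<notin> W" "a \<noteq> b"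
  proof (cases "p \<in> W")
    case True
    then show ?thesis using that[of p q] pq assms by auto
  next
    case False
    then show ?thesis using that[of q p] pq assms by auto
  qed
  have "b \<noteq> v" using ab vx by auto
  have aB: "a \<in> B"
  proof (rule ccontr)
    assume "a \<notin> B"
    then have a: "a \<in> W" "a \<noteq> v" using ab assms vx by auto
    obtain z where z: "(b, z) \<in> (outer_adj E W)\<^sup>*" "z \<notin> W" "{z, v} \<in> E"
      using block_path_to_attachment[OF ab(2) \<open>b \<noteq> v\<close>] by metis
    have "{a, b} \<in> E" using ab(1) assms(1) by simp
    then have "a = v" by (rule path_closedD[OF W a(1) vx(1) ab(3) z(2) _ z(3,1)])
    then show False using a by simp
  qed
  have ns': "nonseparable B (insert e F)"
    unfolding nonseparable_def graph_connected_adj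
  proof (intro conjI ballI)
    fix u w assume "u \<in> B" "w \<in> B"
    then have "(u, w) \<in> (adj F)\<^sup>*"
      by (rule graph_connectedD[rotated]) (use ns in \<open>simp add: nonseparable_def\<close>)
    then show "(u, w) \<in> (adj (insert e F))\<^sup>*"
      by (rule adj_rtrancl_mono) auto
  next
    fix t u w assume t: "t \<in> B" "u \<in> B - {t}" "w \<in> B - {t}"
    from t(2,3) have "(u, w) \<in> (adj {e \<in> F. t \<notin> e})\<^sup>*"
      by (rule graph_connectedD[rotated]) (use ns t(1) in \<open>simp add: nonseparable_def\<close>)
    then show "(u, w) \<in> (adj {e' \<in> insert e F. t \<notin> e'})\<^sup>*"
      by (rule adj_rtrancl_mono) auto
  qed
  have "subgraph B (insert e F) V E"
    using sub assms(1) ab aB \<open>card e = 2\<close> by (auto simp: subgraph_def simple_graph_def)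
  then have "insert e F = F" using mx[OF _ ns'] by auto
  then show ?thesis by auto
qed

end

lemma ex_block_through_edge:
  assumes G: "simple_graph V E" and e: "{u, v} \<in> E"
  obtains B F where "is_block B F V E" "u \<in> B" "v \<in> B" "{u, v} \<in> F"
proof -
  have "card {u, v} = 2" "{u, v} \<subseteq> V" using simple_graph_edgeD[OF G e] by auto
  then have "subgraph {u, v} {{u, v}} V E" using e by (simp add: subgraph_def simple_graph_def)
  from ex_block_of_nonseparable[OF G this nonseparable_edge]
  obtain B F where "is_block B F V E" "{u, v} \<subseteq> B" "{{u, v}} \<subseteq> F" .
  then show ?thesis using that[of B F] by simp
qed

section \<open>Colouring and orienting a single block\<close>

text \<open>A rank that increases along every arc prevents an edge from carrying both of its arcs,
  which is the injectivity demanded by \<open>orientation\<close>.\<close>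

lemma inj_on_edge_of_ranked_arcs:
  fixes r :: "'a \<Rightarrow> nat"
  assumes "\<And>a b. (a, b) \<in> A \<Longrightarrow> r a < r b"
  shows "inj_on (\<lambda>(u, v). {u, v}) A"
proof (rule inj_onI, clarify)
  fix a b c d assume A: "(a, b) \<in> A" "(c, d) \<in> A" and "{a, b} = {c, d}"
  then have "a = c \<and> b = d \<or> a = d \<and> b = c" by (simp add: doubleton_eq_iff)
  then show "a = c \<and> b = d" using assms[OF A(1)] assms[OF A(2)] by auto
qed

lemma ex_third_colour: "\<exists>b \<in> {1, 2, 3 :: nat}. b \<noteq> c \<and> b \<noteq> a"
proof -
  have "\<exists>b. (b = 1 \<or> b = 2 \<or> b = 3) \<and> b \<noteq> c \<and> b \<noteq> a" by presburger
  then show ?thesis by blast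
qed

text \<open>Greedy from the \<open>c\<close> end: an interior vertex avoids the colour before it,
  and only the last one must avoid \<open>a\<close> too. The double \<open>Suc\<close> guarantees an
  interior vertex, so \<open>c = a\<close> is possible; the end colours are arbitrary, and
  \<open>c\<close> can be \<open>0\<close>.\<close>

lemma ex_colouring_of_path:
  fixes c a :: nat
  shows "\<exists>d. d 0 = c \<and> d (Suc (Suc m)) = a \<and> (\<forall>i. 0 < i \<longrightarrow> i < Suc (Suc m) \<longrightarrow> d i \<in> {1, 2, 3}) \<and>
    (\<forall>i < Suc (Suc m). d i \<noteq> d (Suc i))"
proof (induction m arbitrary: c)
  case 0
  obtain b where "b \<in> {1, 2, 3}" "b \<noteq> c" "b \<noteq> a" using ex_third_colour[of c a] by (elim bexE conjE)
  then show ?case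
    by (intro exI[of _ "\<lambda>i. if i = 0 then c else if i = 1 then b else a"]) (auto simp: less_Suc_eq)
next
  case (Suc m)
  obtain b where b: "b \<in> {1, 2, 3}" "b \<noteq> c" using ex_third_colour[of c c] by (elim bexE conjE)
  obtain d where d: "d 0 = b" "d (Suc (Suc m)) = a" "\<And>i. 0 < i \<Longrightarrow> i < Suc (Suc m) \<Longrightarrow> d i \<in> {1, 2, 3}"
    "\<And>i. i < Suc (Suc m) \<Longrightarrow> d i \<noteq> d (Suc i)"
    using Suc[of b] by blast
  let ?d = "case_nat c d"
  have "?d i \<in> {1, 2, 3}" if "0 < i" "i < Suc (Suc (Suc m))" for i
    using that b(1) d(1) d(3)[of "i - 1"] by (cases i; cases "i = 1") auto
  moreover have "?d i \<noteq> ?d (Suc i)" if "i < Suc (Suc (Suc m))" for i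
    using that b(2) d(1) d(4)[of "i - 1"] by (cases i) auto
  ultimately show ?case using d(2) by (intro exI[of _ ?d]) simp
qed

text \<open>No weight enters \<open>v\<close> from the block, so gluing leaves its in-weight
  unchanged. The update by \<open>c\<close> stands for the in-weight that \<open>v\<close> has from
  the rest of the graph, and the block must be proper with respect to that value.\<close>

definition rooted_orientation :: "'a set \<Rightarrow> 'a set set \<Rightarrow> 'a \<Rightarrow> nat \<Rightarrow> ('a \<times> 'a) set \<Rightarrow> ('a \<times> 'a \<Rightarrow> nat) \<Rightarrow> bool" where
  "rooted_orientation B F v c A w \<longleftrightarrow>
     orientation F A \<and> (\<forall>a\<in>A. w a > 0) \<and> in_weight A w v = 0 \<and> (\<forall>x\<in>B. in_weight A w x \<le> 3) \<and>
     (\<forall>x y. {x, y} \<in> F \<longrightarrow> ((in_weight A w)(v := c)) x \<noteq> ((in_weight A w)(v := c)) y)"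

text \<open>Around the cycle \<open>p 0, \<dots>, p k\<close> all arcs point away from \<open>p 0\<close> along the path to \<open>p k\<close>, and
  the closing arc also enters \<open>p k\<close>, whose in-weight therefore has to be \<open>2\<close> or \<open>3\<close>.\<close>

lemma ex_rooted_orientation_cycle:
  fixes p :: "nat \<Rightarrow> 'a"
  assumes inj: "inj_on p {..k}" and k: "2 \<le> k"
    and F: "F = (\<lambda>i. {p i, p (Suc i)}) ` {..<k} \<union> {{p 0, p k}}"
  shows "\<exists>A w. rooted_orientation (p ` {..k}) F (p 0) c A w"
proof -
  \<comment> \<open>Of the two values possible at \<open>p k\<close>, one that differs from the
    colour \<open>c\<close> of its neighbour \<open>p 0\<close>.\<close>
  define a :: nat where "a = (if c = 2 then 3 else 2)"
  then have a: "a \<in> {2, 3}" "a \<noteq> c" by auto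
  obtain m where m: "k = Suc (Suc m)" using k by (metis add_2_eq_Suc le_Suc_ex)
  obtain d where d: "d 0 = c" "d k = a" "\<And>i. 0 < i \<Longrightarrow> i < k \<Longrightarrow> d i \<in> {1, 2, 3}"
    "\<And>i. i < k \<Longrightarrow> d i \<noteq> d (Suc i)"
    using ex_colouring_of_path[of c m a] unfolding m by blast
  \<comment> \<open>\<open>r\<close> is the position on the cycle; every arc of \<open>A\<close>,
    including the closing one from \<open>p 0\<close> to \<open>p k\<close>, increases it.\<close>
  define r where "r = the_inv_into {..k} p"
  have r: "r (p i) = i" if "i \<le> k" for i
    using that inj by (simp add: r_def the_inv_into_f_f)
  define A where "A = (\<lambda>i. (p i, p (Suc i))) ` {..<k} \<union> {(p 0, p k)}"
  \<comment> \<open>A single incoming arc carries the colour of its head. At \<open>p k\<close> the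
    closing arc, recognised by its tail at position \<open>0\<close>, has weight \<open>1\<close>,
    and the arc along the path has the positive rest \<open>d k - 1\<close>; the tails differ
    because \<open>k \<ge> 2\<close>.\<close>
  define w where "w = (\<lambda>(x, y). if r y = k then (if r x = 0 then 1 else d k - 1) else d (r y))"
  have "inj_on (\<lambda>(u, v). {u, v}) A"
    by (rule inj_on_edge_of_ranked_arcs[where r = r]) (use k in \<open>auto simp: A_def r\<close>)
  moreover have "(\<lambda>(u, v). {u, v}) ` A = F" by (simp add: A_def F image_image)
  ultimately have or: "orientation F A" by (simp add: orientation_def bij_betw_def)
  have pos: "w e > 0" if e: "e \<in> A" for e
  proof -
    consider i where "i < k" "e = (p i, p (Suc i))" | "e = (p 0, p k)" using e by (auto simp: A_def)
    then show ?thesis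
    proof cases
      case 1
      then show ?thesis using a d(2) d(3)[of "Suc i"] by (auto simp: w_def r)
    next
      case 2
      then show ?thesis by (simp add: w_def r)
    qed
  qed
  have p_eq: "p i = p j \<longleftrightarrow> i = j" if "i \<le> k" "j \<le> k" for i j
    using that inj by (auto simp: inj_on_def)
  have in_w: "in_weight A w (p j) = (if j = 0 then 0 else d j)" if j: "j \<le> k" for j
  proof -
    consider "j = 0" | i where "j = Suc i" "j < k" | "j = k" using j by (cases j) (auto simp: le_less)
    then show ?thesis
    proof cases
      case 1
      then have "{e \<in> A. snd e = p j} = {}" using k by (auto simp: A_def p_eq)
      then show ?thesis using 1 unfolding in_weight_def by (metis sum.empty)
    next
      case 2
      then have "{e \<in> A. snd e = p j} = {(p i, p j)}" using k by (auto simp: A_def p_eq)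
      then show ?thesis using 2 by (simp add: in_weight_def w_def r)
    next
      case 3
      then have "{e \<in> A. snd e = p j} = {(p (Suc m), p k), (p 0, p k)}"
        using m by (auto simp: A_def p_eq)
      moreover have "p (Suc m) \<noteq> p 0" using m by (simp add: p_eq)
      ultimately show ?thesis using 3 a d(2) m by (auto simp: in_weight_def w_def r)
    qed
  qed
  have le: "in_weight A w x \<le> 3" if x: "x \<in> p ` {..k}" for x
  proof -
    obtain j where j: "j \<le> k" "x = p j" using x by auto
    show ?thesis
    proof (cases "j = 0 \<or> j = k")
      case True
      then show ?thesis unfolding j(2) in_w[OF j(1)] using d(2) a(1) by auto
    next
      case False
      then have "d j \<in> {1, 2, 3}" using j(1) by (intro d(3)) auto
      then show ?thesis unfolding j(2) in_w[OF j(1)] by auto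
    qed
  qed
  have up: "((in_weight A w)(p 0 := c)) (p j) = d j" if "j \<le> k" for j
    using in_w[OF that] that d(1) p_eq[of j 0] by auto
  have ne: "((in_weight A w)(p 0 := c)) x \<noteq> ((in_weight A w)(p 0 := c)) y" if e: "{x, y} \<in> F" for x y
  proof -
    consider i where "i < k" "{x, y} = {p i, p (Suc i)}" | "{x, y} = {p 0, p k}" using e by (auto simp: F)
    then obtain i j where ij: "i \<le> k" "j \<le> k" "{x, y} = {p i, p j}" "d i \<noteq> d j"
    proof cases
      case 1
      then show ?thesis using that[of i "Suc i"] d(4) by simp
    next
      case 2
      then show ?thesis using that[of 0 k] d(1,2) a by simp
    qed
    then have "x = p i \<and> y = p j \<or> x = p j \<and> y = p i" by (simp add: doubleton_eq_iff)
    then show ?thesis using up[OF ij(1)] up[OF ij(2)] ij(4) by metis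
  qed
  have "in_weight A w (p 0) = 0" using in_w[of 0] by simp
  then have "rooted_orientation (p ` {..k}) F (p 0) c A w"
    unfolding rooted_orientation_def using or pos le ne by blast
  then show ?thesis by blast
qed

text \<open>The edge set from \<open>is_cycle_graph\<close>, named in order to show that it is
  invariant under rotation; a rotation brings the root \<open>v\<close> to position
  \<open>0\<close>.\<close>

definition cycle_edges :: "'a list \<Rightarrow> 'a set set" where
  "cycle_edges xs = {{xs ! i, xs ! (Suc i mod length xs)} | i. i < length xs}"

lemma cycle_edges_rotate_subset: "cycle_edges (rotate s xs) \<subseteq> cycle_edges xs"
proof
  fix e assume "e \<in> cycle_edges (rotate s xs)"
  then obtain i where i: "i < length xs" "e = {rotate s xs ! i, rotate s xs ! (Suc i mod length xs)}"
    by (auto simp: cycle_edges_def)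
  let ?j = "(s + i) mod length xs"
  have "Suc i mod length xs < length xs" using i by (cases xs) auto
  then have "e = {xs ! ?j, xs ! (Suc ?j mod length xs)}"
    using i by (simp add: nth_rotate mod_simps)
  moreover have "?j < length xs" using i by (cases xs) auto
  ultimately show "e \<in> cycle_edges xs" by (auto simp: cycle_edges_def)
qed

lemma cycle_edges_rotate: "cycle_edges (rotate s xs) = cycle_edges xs"
proof
  show "cycle_edges (rotate s xs) \<subseteq> cycle_edges xs" by (rule cycle_edges_rotate_subset)
  show "cycle_edges xs \<subseteq> cycle_edges (rotate s xs)"
  proof (cases "xs = []")
    case False
    \<comment> \<open>Both rotations together make \<open>s\<close> full turns, so the inclusion
      already shown, applied to the second rotation, is the converse one.\<close>
    have "rotate (s * (length xs - 1)) (rotate s xs) = rotate (s * length xs) xs"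
      using False by (cases xs) (simp_all add: rotate_rotate add.commute)
    also have "\<dots> = xs" by (rule rotate_id) simp
    finally show ?thesis using cycle_edges_rotate_subset[of "s * (length xs - 1)" "rotate s xs"] by simp
  qed (simp add: cycle_edges_def)
qed

lemma ex_rooted_orientation:
  assumes "is_edge_graph B F \<or> is_cycle_graph B F" and v: "v \<in> B"
  shows "\<exists>A w. rooted_orientation B F v c A w"
  using assms(1)
proof
  assume "is_edge_graph B F"
  then obtain x where x: "x \<noteq> v" "B = {v, x}" "F = {{v, x}}"
    using v unfolding is_edge_graph_def by (metis insert_commute insertE singletonD)
  \<comment> \<open>The only arc enters \<open>x\<close>, so its weight is the in-weight of
    \<open>x\<close> and merely has to avoid \<open>c\<close>.\<close>
  define k :: nat where "k = (if c = 1 then 2 else 1)"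
  then have k: "k \<noteq> c" "0 < k" "k \<le> 3" by auto
  let ?w = "\<lambda>_. k"
  have inw: "in_weight {(v, x)} ?w y = (if y = x then k else 0)" for y
  proof -
    have "{a \<in> {(v, x)}. snd a = y} = (if y = x then {(v, x)} else {})" by auto
    then show ?thesis unfolding in_weight_def by (smt (verit) sum.empty sum.insert finite.emptyI empty_iff add_0_right)
  qed
  have "rooted_orientation B F v c {(v, x)} ?w"
    unfolding rooted_orientation_def
  proof (intro conjI)
    show "orientation F {(v, x)}" using x by (simp add: orientation_def bij_betw_def)
    show "\<forall>y z. {y, z} \<in> F \<longrightarrow> ((in_weight {(v, x)} ?w)(v := c)) y \<noteq> ((in_weight {(v, x)} ?w)(v := c)) z"
      using x k by (auto simp: inw doubleton_eq_iff)
  qed (use x k in \<open>auto simp: inw\<close>)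
  then show ?thesis by blast
next
  assume "is_cycle_graph B F"
  then obtain xs where xs: "distinct xs" "length xs \<ge> 3" "B = set xs" "F = cycle_edges xs"
    by (auto simp: is_cycle_graph_def cycle_edges_def)
  obtain s where s: "s < length xs" "v = xs ! s" using v xs(3) by (auto simp: in_set_conv_nth)
  define ys where "ys = rotate s xs"
  have ys: "distinct ys" "length ys \<ge> 3" "B = set ys" "F = cycle_edges ys"
    using xs by (auto simp: ys_def cycle_edges_rotate)
  have v0: "ys ! 0 = v" using s nth_rotate[of 0 xs s] by (cases xs) (simp_all add: ys_def)
  define k where "k = length ys - 1"
  have k: "length ys = Suc k" "2 \<le> k" using ys(2) by (auto simp: k_def)
  have inj: "inj_on ((!) ys) {..k}" using ys(1) k by (auto intro!: inj_on_nth)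
  have B: "((!) ys) ` {..k} = B" unfolding ys(3) using k by (auto simp: set_conv_nth less_Suc_eq_le)
  have "F = (\<lambda>i. {ys ! i, ys ! (Suc i mod Suc k)}) ` {..<Suc k}"
    unfolding ys(4) cycle_edges_def k by auto
  \<comment> \<open>The last index is split off: its successor modulo \<open>Suc k\<close> is
    \<open>0\<close>, which gives the closing edge.\<close>
  also have "\<dots> = (\<lambda>i. {ys ! i, ys ! (Suc i mod Suc k)}) ` {..<k} \<union> {{ys ! k, ys ! 0}}"
    unfolding lessThan_Suc by simp
  also have "\<dots> = (\<lambda>i. {ys ! i, ys ! Suc i}) ` {..<k} \<union> {{ys ! 0, ys ! k}}"
    by (intro arg_cong2[where f = "(\<union>)"] image_cong) auto
  finally show ?thesis using ex_rooted_orientation_cycle[OF inj k(2)] unfolding B v0 by metis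
qed

section \<open>Gluing blocks together: the upper bound\<close>

lemma in_weight_Un:
  assumes "finite A1" "finite A2" "A1 \<inter> A2 = {}"
  shows "in_weight (A1 \<union> A2) (\<lambda>a. if a \<in> A1 then w1 a else w2 a) x = in_weight A1 w1 x + in_weight A2 w2 x"
proof -
  let ?w = "\<lambda>a. if a \<in> A1 then w1 a else w2 a"
  have "{a \<in> A1 \<union> A2. snd a = x} = {a \<in> A1. snd a = x} \<union> {a \<in> A2. snd a = x}" by auto
  moreover have "sum ?w ({a \<in> A1. snd a = x} \<union> {a \<in> A2. snd a = x}) =
      sum ?w {a \<in> A1. snd a = x} + sum ?w {a \<in> A2. snd a = x}"
    by (rule sum.union_disjoint) (use assms in auto)
  moreover have "sum ?w {a \<in> A1. snd a = x} = sum w1 {a \<in> A1. snd a = x}"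
    by (rule sum.cong) auto
  moreover have "sum ?w {a \<in> A2. snd a = x} = sum w2 {a \<in> A2. snd a = x}"
    by (rule sum.cong) (use assms(3) in auto)
  ultimately show ?thesis by (simp add: in_weight_def)
qed

lemma orientation_edge: "orientation E A \<Longrightarrow> (a, b) \<in> A \<Longrightarrow> {a, b} \<in> E"
  unfolding orientation_def by (drule bij_betwE) auto

lemma orientation_finite: "orientation E A \<Longrightarrow> finite E \<Longrightarrow> finite A"
  unfolding orientation_def by (simp add: bij_betw_finite)

lemma in_weight_eq_0:
  assumes "orientation E A" "\<And>e. e \<in> E \<Longrightarrow> x \<notin> e"
  shows "in_weight A w x = 0"
proof -
  have "{a \<in> A. snd a = x} = {}" using orientation_edge[OF assms(1)] assms(2) by fastforce
  then show ?thesis by (simp only: in_weight_def sum.empty)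
qed

lemma finite_edges: "simple_graph V E \<Longrightarrow> finite E"
  unfolding simple_graph_def by (metis Pow_iff finite_Pow_iff finite_subset subsetI)

text \<open>The bound ranges over the whole type, since vertices on no edge have in-weight
  \<open>0\<close>; edge sets can thus be united without carrying a vertex set along.\<close>

definition three_bounded :: "'a set set \<Rightarrow> bool" where
  "three_bounded E \<longleftrightarrow> (\<exists>A w. semi_proper_orientation E A w \<and> (\<forall>x. in_weight A w x \<le> 3))"

text \<open>The block is rooted at \<open>v\<close>, with the in-weight of \<open>v\<close> in
  \<open>E1\<close> as the prescribed colour. Every vertex other than \<open>v\<close> receives arcs
  from at most one side, and \<open>v\<close> gains nothing from the block, so each edge is proper
  by the side to which it belongs.\<close>

lemma three_bounded_Un_block:
  assumes fin: "finite E1" "finite F"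
    and E1: "\<And>e. e \<in> E1 \<Longrightarrow> e \<subseteq> W" and F: "\<And>e. e \<in> F \<Longrightarrow> e \<subseteq> B \<and> card e = 2" and BW: "B \<inter> W = {v}"
    and tb: "three_bounded E1" and blk: "is_edge_graph B F \<or> is_cycle_graph B F"
  shows "three_bounded (E1 \<union> F)"
proof -
  obtain A1 w1 where "semi_proper_orientation E1 A1 w1" and le1: "\<And>x. in_weight A1 w1 x \<le> 3"
    using tb unfolding three_bounded_def by blast
  then have or1: "orientation E1 A1" and pos1: "\<And>a. a \<in> A1 \<Longrightarrow> w1 a > 0"
    and ne1: "\<And>x y. {x, y} \<in> E1 \<Longrightarrow> in_weight A1 w1 x \<noteq> in_weight A1 w1 y"
    by (simp_all add: semi_proper_orientation_def)
  let ?c = "in_weight A1 w1 v"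
  have "v \<in> B" using BW by blast
  from ex_rooted_orientation[OF blk this] obtain A2 w2 where "rooted_orientation B F v ?c A2 w2" by blast
  then have or2: "orientation F A2" and pos2: "\<And>a. a \<in> A2 \<Longrightarrow> w2 a > 0"
    and v2: "in_weight A2 w2 v = 0" and le2: "\<And>x. x \<in> B \<Longrightarrow> in_weight A2 w2 x \<le> 3"
    and ne2: "\<And>x y. {x, y} \<in> F \<Longrightarrow> ((in_weight A2 w2)(v := ?c)) x \<noteq> ((in_weight A2 w2)(v := ?c)) y"
    unfolding rooted_orientation_def by blast+
  have disj: "E1 \<inter> F = {}"
  proof (rule ccontr)
    assume "E1 \<inter> F \<noteq> {}"
    then obtain e where e: "e \<in> E1" "e \<in> F" by blast
    then have "e \<subseteq> {v}" using E1[OF e(1)] F[OF e(2)] BW by blast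
    then have "card e \<le> 1" using card_mono[of "{v}" e] by simp
    then show False using F[OF e(2)] by simp
  qed
  have Adisj: "A1 \<inter> A2 = {}"
    using orientation_edge[OF or1] orientation_edge[OF or2] disj by fastforce
  define A where "A = A1 \<union> A2"
  define w where "w = (\<lambda>a. if a \<in> A1 then w1 a else w2 a)"
  have or: "orientation (E1 \<union> F) A"
    using bij_betw_combine[OF or1[unfolded orientation_def] or2[unfolded orientation_def] disj]
    by (simp add: A_def orientation_def)
  have pos: "w a > 0" if "a \<in> A" for a
    using that pos1[of a] pos2[of a] by (cases "a \<in> A1") (simp_all add: A_def w_def)
  have in_w: "in_weight A w x = in_weight A1 w1 x + in_weight A2 w2 x" for x
    unfolding A_def w_def
    by (rule in_weight_Un) (use orientation_finite or1 or2 fin Adisj in auto)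
  have inW: "in_weight A w x = in_weight A1 w1 x" if x: "x \<in> W" for x
  proof (cases "x = v")
    case False
    then have "x \<notin> B" using x BW by blast
    then have "in_weight A2 w2 x = 0" using F by (intro in_weight_eq_0[OF or2]) blast
    then show ?thesis using in_w by simp
  qed (simp add: in_w v2)
  have notW: "in_weight A w x = in_weight A2 w2 x" if x: "x \<notin> W" for x
  proof -
    have "in_weight A1 w1 x = 0" using E1 x by (intro in_weight_eq_0[OF or1]) blast
    then show ?thesis using in_w by simp
  qed
  have inB: "in_weight A w x = ((in_weight A2 w2)(v := ?c)) x" if x: "x \<in> B" for x
  proof (cases "x = v")
    case True
    then show ?thesis by (simp add: in_w v2)
  next
    case False
    then have "x \<notin> W" using x BW by blast
    then show ?thesis using notW False by simp
  qed
  have le: "in_weight A w x \<le> 3" for x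
  proof -
    consider "x \<in> W" | "x \<notin> W" "x \<in> B" | "x \<notin> W" "x \<notin> B" by blast
    then show ?thesis
    proof cases
      case 3
      then have "in_weight A2 w2 x = 0" using F by (intro in_weight_eq_0[OF or2]) blast
      then show ?thesis using notW[OF 3(1)] by simp
    qed (simp_all add: inW le1 notW le2)
  qed
  have ne: "in_weight A w x \<noteq> in_weight A w y" if e: "{x, y} \<in> E1 \<union> F" for x y
  proof (cases "{x, y} \<in> E1")
    case True
    then have "x \<in> W" "y \<in> W" using E1 by blast+
    then show ?thesis using ne1[OF True] inW by simp
  next
    case False
    then have xy: "{x, y} \<in> F" using e by blast
    then have "x \<in> B" "y \<in> B" using F by blast+
    then show ?thesis using ne2[OF xy] inB by simp
  qed
  have "semi_proper_orientation (E1 \<union> F) A w"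
    unfolding semi_proper_orientation_def using or pos ne by blast
  then show ?thesis unfolding three_bounded_def using le by blast
qed

text \<open>Used to start a new component once no edge leaves \<open>W\<close>: a path outside
  \<open>insert y W\<close> can then be attached only to \<open>y\<close>, at both ends.\<close>

lemma path_closed_insert_isolated:
  assumes "\<And>u x. u \<in> W \<Longrightarrow> x \<notin> W \<Longrightarrow> {u, x} \<notin> E"
  shows "path_closed E (insert y W)"
  unfolding path_closed_def
proof (intro ballI allI impI, elim conjE)
  fix u v a b
  assume uv: "u \<in> insert y W" "v \<in> insert y W" and ab: "a \<notin> insert y W" "b \<notin> insert y W"
    and e: "{u, a} \<in> E" "{b, v} \<in> E"
  have "u \<notin> W" using assms[of u a] e(1) ab by blast
  moreover have "v \<notin> W" using assms[of v b] e(2) ab by (auto simp: insert_commute)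
  ultimately show "u = v" using uv by simp
qed

text \<open>Induction on the number of vertices outside \<open>W\<close>, starting from
  \<open>W = {}\<close>. If an edge leaves \<open>W\<close>, a block through it is added. Otherwise
  any further vertex is added alone; it brings in no edge and serves as a root with in-weight
  \<open>0\<close>.\<close>

lemma three_bounded_if_blocks:
  assumes G: "simple_graph V E"
    and blocks: "\<And>B F. is_block B F V E \<Longrightarrow> F \<noteq> {} \<Longrightarrow> is_edge_graph B F \<or> is_cycle_graph B F"
  shows "three_bounded E"
proof -
  have finV: "finite V" using G by (simp add: simple_graph_def)
  have step: "three_bounded E" if "path_closed E W" "W \<subseteq> V" "three_bounded {e \<in> E. e \<subseteq> W}" for W
    using that
  proof (induction "card (V - W)" arbitrary: W rule: less_induct)
    case less
    show ?case
    proof (cases "\<exists>v x. v \<in> W \<and> x \<notin> W \<and> {v, x} \<in> E")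
      case True
      then obtain v x where vx: "v \<in> W" "x \<notin> W" "{v, x} \<in> E" by blast
      obtain B F where BF: "is_block B F V E" "v \<in> B" "x \<in> B" "{v, x} \<in> F"
        using ex_block_through_edge[OF G vx(3)] by metis
      have BV: "B \<subseteq> V" and FE: "F \<subseteq> E" and sF: "simple_graph B F"
        using is_blockD(1)[OF BF(1)] by (simp_all add: subgraph_def)
      note BW = block_Int_path_closed[OF G less.prems(1) BF(1) vx BF(2,3)]
      have "{e \<in> E. e \<subseteq> W \<union> B} \<subseteq> {e \<in> E. e \<subseteq> W} \<union> F"
        using edge_in_Un_block[OF G less.prems(1) BF(1) vx BF(2,3)] by blast
      moreover have "{e \<in> E. e \<subseteq> W} \<union> F \<subseteq> {e \<in> E. e \<subseteq> W \<union> B}"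
        using FE simple_graph_edgeD(1)[OF sF] by blast
      moreover have "three_bounded ({e \<in> E. e \<subseteq> W} \<union> F)"
      proof (rule three_bounded_Un_block[OF _ _ _ _ BW less.prems(3)])
        show "is_edge_graph B F \<or> is_cycle_graph B F" using blocks[OF BF(1)] BF(4) by blast
        show "e \<subseteq> B \<and> card e = 2" if "e \<in> F" for e using simple_graph_edgeD[OF sF that] by simp
      qed (use finite_edges[OF G] finite_edges[OF sF] in auto)
      ultimately have tb: "three_bounded {e \<in> E. e \<subseteq> W \<union> B}" by (metis subset_antisym)
      have "card (V - (W \<union> B)) < card (V - W)"
        by (rule psubset_card_mono) (use finV vx BF BV in auto)
      from less.hyps[OF this path_closed_Un_block[OF G less.prems(1) BF(1) vx BF(2,3)] _ tb]
      show ?thesis using less.prems(2) BV by blast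
    next
      case False
      then have no: "\<And>v x. v \<in> W \<Longrightarrow> x \<notin> W \<Longrightarrow> {v, x} \<notin> E" by blast
      show ?thesis
      proof (cases "W = V")
        case True
        then have "{e \<in> E. e \<subseteq> W} = E" using simple_graph_edgeD(1)[OF G] by blast
        then show ?thesis using less.prems(3) by metis
      next
        case False
        then obtain y where y: "y \<in> V" "y \<notin> W" using less.prems(2) by blast
        have "e \<subseteq> W" if e: "e \<in> E" "e \<subseteq> insert y W" for e
        proof (rule ccontr)
          assume "\<not> e \<subseteq> W"
          then have "y \<in> e" using e by blast
          moreover obtain a b where ab: "e = {a, b}" "a \<noteq> b"
            using simple_graph_edgeD(2)[OF G e(1)] by (meson card_2_iff)
          ultimately obtain z where z: "e = {z, y}" "z \<noteq> y" by (metis insert_commute insertE singletonD)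
          then have "z \<in> W" using e(2) by blast
          then show False using no[of z y] y z e by blast
        qed
        then have "{e \<in> E. e \<subseteq> insert y W} = {e \<in> E. e \<subseteq> W}" by blast
        then have tb: "three_bounded {e \<in> E. e \<subseteq> insert y W}" using less.prems(3) by metis
        have "card (V - insert y W) < card (V - W)"
          by (rule psubset_card_mono) (use finV y in auto)
        from less.hyps[OF this path_closed_insert_isolated[OF no] _ tb]
        show ?thesis using less.prems(2) y by blast
      qed
    qed
  qed
  have "{e \<in> E. e \<subseteq> {}} = {}" using simple_graph_edgeD(2)[OF G] by fastforce
  moreover have "three_bounded {}"
    unfolding three_bounded_def semi_proper_orientation_def
    by (intro exI[of _ "{}"]) (simp add: orientation_def in_weight_def bij_betw_def)
  ultimately have "three_bounded {e \<in> E. e \<subseteq> {}}" by metis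
  then show ?thesis by (rule step[rotated 2]) (simp_all add: path_closed_def)
qed

lemma cactus_number_le_3:
  assumes "cactus V E"
  shows "semi_proper_orientation_number V E \<le> 3"
proof -
  have G: "simple_graph V E" using assms by (simp add: cactus_def)
  have "three_bounded E" by (rule three_bounded_if_blocks[OF G]) (use assms in \<open>simp add: cactus_def\<close>)
  then obtain A w where Aw: "semi_proper_orientation E A w" "\<And>x. in_weight A w x \<le> 3"
    unfolding three_bounded_def by blast
  have "max_in_weight V A w \<le> 3"
    unfolding max_in_weight_def using G Aw(2) by (subst Max_le_iff) (auto simp: simple_graph_def)
  then have "enat (max_in_weight V A w) \<le> 3" by (simp add: numeral_eq_enat)
  moreover have "semi_proper_orientation_number V E \<le> enat (max_in_weight V A w)"
    unfolding semi_proper_orientation_number_def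
    by (rule INF_lower2[of "(A, w)"]) (use Aw in auto)
  ultimately show ?thesis by (rule order_trans[rotated])
qed

section \<open>Outerplanar drawings by chords of a parabola\<close>

text \<open>\<open>(x - a) * (b - x)\<close> is the height at \<open>x\<close> of the chord over
  \<open>[a, b]\<close> above the parabola \<open>y = x^2\<close>, so \<open>eq\<close> says that
  two chords meet there. For nested intervals the outer chord is strictly higher except at a shared
  end, and intervals side by side have at most an end in common.\<close>

lemma chords_common_point:
  fixes a b c d x :: real
  assumes "a < b" "c < d" "a \<le> x" "x \<le> b" "c \<le> x" "x \<le> d"
    and eq: "(x - a) * (b - x) = (x - c) * (d - x)"
    and nc: "\<not> (a < c \<and> c < b \<and> b < d)" "\<not> (c < a \<and> a < d \<and> d < b)" and ne: "\<not> (a = c \<and> b = d)"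
  shows "x \<in> {a, b} \<and> x \<in> {c, d}"
proof -
  \<comment> \<open>By symmetry between the two chords, \<open>a \<le> c\<close> may be
    assumed.\<close>
  have main: "x \<in> {a, b} \<and> x \<in> {c, d}"
    if H: "a < b" "c < d" "a \<le> x" "x \<le> b" "c \<le> x" "x \<le> d"
    "(x - a) * (b - x) = (x - c) * (d - x)" "\<not> (a < c \<and> c < b \<and> b < d)" "\<not> (a = c \<and> b = d)" "a \<le> c"
    for a b c d :: real
  proof -
    consider "b \<le> c" | "a = c" "b \<noteq> d" | "a < c" "d \<le> b" using H by linarith
    then show ?thesis
    proof cases
      case 1
      then have "x = b" "x = c" using H by linarith+
      then show ?thesis by simp
    next
      case 2
      then have "(x - a) * (b - d) = 0" using H(7) by (simp add: algebra_simps)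
      then have "x = a" using 2 by simp
      then show ?thesis using 2 by simp
    next
      case 3
      show ?thesis
      proof (cases "x = d")
        case True
        then have "(x - a) * (b - x) = 0" using H(7) by simp
        then have "x = b" using H 3 by auto
        then show ?thesis using True by simp
      next
        case False
        then have "0 < d - x" using H by simp
        then have "(x - c) * (d - x) < (x - a) * (d - x)" using 3 by simp
        also have "\<dots> \<le> (x - a) * (b - x)" using 3 H by (intro mult_left_mono) auto
        finally show ?thesis using H(7) by simp
      qed
    qed
  qed
  show ?thesis
  proof (cases "a \<le> c")
    case True
    then show ?thesis using main[of a b c d] assms by simp
  next
    case False
    then show ?thesis using main[of c d a b] assms by auto
  qed
qed

text \<open>On a strictly convex curve every point is extreme in the hull of the points, and two
  chords cross only if their pairs of labels interlace.\<close>

definition parabola_point :: "nat \<Rightarrow> complex" where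
  "parabola_point n = Complex (real n) ((real n)\<^sup>2)"

text \<open>Rests on \<open>x^2 + (x - a) * (b - x) = (a + b) * x - a * b\<close>, whose right-hand
  side is the line through the two points.\<close>

lemma closed_segment_parabola:
  assumes ab: "a < b" and z: "z \<in> closed_segment (parabola_point a) (parabola_point b)"
  shows "real a \<le> Re z" "Re z \<le> real b" "Im z = (Re z)\<^sup>2 + (Re z - real a) * (real b - Re z)"
proof -
  obtain u where u: "0 \<le> u" "u \<le> 1" "z = (1 - u) *\<^sub>R parabola_point a + u *\<^sub>R parabola_point b"
    using z by (auto simp: in_segment)
  have re: "Re z = real a + u * (real b - real a)" and im: "Im z = (1 - u) * (real a)\<^sup>2 + u * (real b)\<^sup>2"
    unfolding u(3) by (simp_all add: parabola_point_def algebra_simps)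
  have "0 \<le> u * (real b - real a)" "u * (real b - real a) \<le> 1 * (real b - real a)"
    using u(1,2) ab by (auto intro!: mult_right_mono)
  then show "real a \<le> Re z" "Re z \<le> real b" using re by auto
  show "Im z = (Re z)\<^sup>2 + (Re z - real a) * (real b - Re z)"
    unfolding re im by (simp add: power2_eq_square algebra_simps)
qed

lemma parabola_point_eqI:
  "Re z = real n \<Longrightarrow> Im z = (Re z)\<^sup>2 \<Longrightarrow> z = parabola_point n"
  by (simp add: parabola_point_def complex_eq_iff)

lemma inj_parabola_point: "inj parabola_point"
  by (rule injI) (simp add: parabola_point_def)

definition chord :: "nat set \<Rightarrow> real \<Rightarrow> complex" where
  "chord e = linepath (parabola_point (Min e)) (parabola_point (Max e))"

lemma chord_pair: "a < b \<Longrightarrow> chord {a, b} = linepath (parabola_point a) (parabola_point b)"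
  by (simp add: chord_def)

text \<open>The segments lie in the convex hull of the points, whose complement touches each point
  from below the parabola.\<close>

lemma outerplanar_noncrossing:
  fixes V :: "nat set"
  assumes V: "finite V" and E: "\<And>e. e \<in> E \<Longrightarrow> \<exists>a b. a < b \<and> e = {a, b} \<and> a \<in> V \<and> b \<in> V"
    and nc: "\<And>a b c d. {a, b} \<in> E \<Longrightarrow> {c, d} \<in> E \<Longrightarrow> a < c \<Longrightarrow> c < b \<Longrightarrow> b < d \<Longrightarrow> False"
  shows "outerplanar V E"
proof -
  let ?p = parabola_point
  have pinj: "?p i = ?p j \<longleftrightarrow> i = j" for i j using inj_parabola_point by (auto simp: inj_def)
  have vertex: "path_image (chord e) \<inter> ?p ` V = ?p ` e" if e: "e \<in> E" for e
  proof -
    obtain a b where ab: "a < b" "e = {a, b}" "a \<in> V" "b \<in> V" using E[OF e] by blast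
    have "?p n \<in> ?p ` e" if n: "?p n \<in> closed_segment (?p a) (?p b)" for n
    proof -
      \<comment> \<open>A point of the parabola has height \<open>0\<close> above it, and on the
        chord this height is a product that vanishes only at \<open>a\<close> and
        \<open>b\<close>.\<close>
      have "(real n)\<^sup>2 = (real n)\<^sup>2 + (real n - real a) * (real b - real n)"
        using closed_segment_parabola(3)[OF ab(1) n] by (simp add: parabola_point_def)
      then have "n = a \<or> n = b" by auto
      then show ?thesis using ab by auto
    qed
    then show ?thesis using ab by (auto simp: chord_pair)
  qed
  have cross: "path_image (chord e) \<inter> path_image (chord f) \<subseteq> ?p ` (e \<inter> f)"
    if e: "e \<in> E" and f: "f \<in> E" and ef: "e \<noteq> f" for e f
  proof
    fix z assume z: "z \<in> path_image (chord e) \<inter> path_image (chord f)"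
    obtain a b where ab: "a < b" "e = {a, b}" using E[OF e] by blast
    obtain c d where cd: "c < d" "f = {c, d}" using E[OF f] by blast
    have ze: "z \<in> closed_segment (?p a) (?p b)" and zf: "z \<in> closed_segment (?p c) (?p d)"
      using z ab cd by (simp_all add: chord_pair)
    note A = closed_segment_parabola[OF ab(1) ze] and C = closed_segment_parabola[OF cd(1) zf]
    have eq: "(Re z - real a) * (real b - Re z) = (Re z - real c) * (real d - Re z)"
      using A(3) C(3) by linarith
    have n1: "\<not> (real a < real c \<and> real c < real b \<and> real b < real d)" and
      n2: "\<not> (real c < real a \<and> real a < real d \<and> real d < real b)"
      using nc[of a b c d] nc[of c d a b] e f ab cd by auto
    have n3: "\<not> (real a = real c \<and> real b = real d)" using ef ab cd by auto
    have R: "Re z \<in> {real a, real b} \<and> Re z \<in> {real c, real d}"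
      by (rule chords_common_point[OF _ _ A(1,2) C(1,2) eq n1 n2 n3]) (use ab cd in auto)
    then have "(Re z - real a) * (real b - Re z) = 0" by auto
    then have Im: "Im z = (Re z)\<^sup>2" using A(3) by simp
    from R obtain n where n: "n \<in> e" "Re z = real n" using ab by auto
    then have "n \<in> f" using R cd by auto
    then show "z \<in> ?p ` (e \<inter> f)" using parabola_point_eqI[OF n(2) Im] n(1) by blast
  qed
  have draw: "planar_drawing V E ?p chord"
    unfolding planar_drawing_def
  proof (intro conjI ballI impI)
    show "inj_on ?p V" using inj_parabola_point inj_on_subset by blast
    fix e assume e: "e \<in> E"
    obtain a b where ab: "a < b" "e = {a, b}" using E[OF e] by blast
    show "arc (chord e)" using ab pinj[of a b] by (auto simp: chord_pair arc_linepath)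
    show "{pathstart (chord e), pathfinish (chord e)} = ?p ` e" using ab by (simp add: chord_pair)
  qed (use vertex cross in auto)
  let ?S = "?p ` V \<union> (\<Union>e\<in>E. path_image (chord e))"
  let ?H = "convex hull (?p ` V)"
  have SH: "?S \<subseteq> ?H"
  proof -
    have "path_image (chord e) \<subseteq> ?H" if e: "e \<in> E" for e
    proof -
      obtain a b where ab: "a < b" "e = {a, b}" "a \<in> V" "b \<in> V" using E[OF e] by blast
      then have "closed_segment (?p a) (?p b) \<subseteq> ?H"
        by (intro closed_segment_subset) (auto simp: hull_inc)
      then show ?thesis using ab by (simp add: chord_pair)
    qed
    then show ?thesis using hull_subset[of "?p ` V" convex] by blast
  qed
  have "bounded ?H" using V by (simp add: bounded_convex_hull finite_imp_bounded)
  then have "outside ?H = - ?H" by (intro outside_convex) auto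
  then have out: "- ?H \<subseteq> outside ?S" using outside_mono[OF SH] by simp
  have epi: "?H \<subseteq> {z. (Re z)\<^sup>2 \<le> Im z}"
  proof (rule hull_minimal)
    show "?p ` V \<subseteq> {z. (Re z)\<^sup>2 \<le> Im z}" by (auto simp: parabola_point_def)
    show "convex {z. (Re z)\<^sup>2 \<le> Im z}"
    proof (rule convexI, clarify)
      fix z w :: complex and u v :: real
      assume zw: "(Re z)\<^sup>2 \<le> Im z" "(Re w)\<^sup>2 \<le> Im w" and uv: "0 \<le> u" "0 \<le> v" "u + v = 1"
      \<comment> \<open>The convexity defect of the square function, written as a nonnegative
        term.\<close>
      have "u * (Re z)\<^sup>2 + v * (Re w)\<^sup>2 - (u * Re z + v * Re w)\<^sup>2 = u * v * (Re z - Re w)\<^sup>2"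
      proof -
        have v: "v = 1 - u" using uv by simp
        show ?thesis unfolding v by (simp add: power2_eq_square algebra_simps)
      qed
      moreover have "0 \<le> u * v * (Re z - Re w)\<^sup>2" using uv by simp
      moreover have "u * (Re z)\<^sup>2 \<le> u * Im z" "v * (Re w)\<^sup>2 \<le> v * Im w"
        using zw uv by (auto intro: mult_left_mono)
      ultimately show "(Re (u *\<^sub>R z + v *\<^sub>R w))\<^sup>2 \<le> Im (u *\<^sub>R z + v *\<^sub>R w)" by simp
    qed
  qed
  have "?p n \<in> frontier (outside ?S)" if n: "n \<in> V" for n
  proof -
    have "?p n \<notin> outside ?S" using n outside_no_overlap[of ?S] by blast
    then have int: "?p n \<notin> interior (outside ?S)" using interior_subset by blast
    have "?p n \<in> closure (outside ?S)"
      unfolding closure_approachable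
    proof (intro allI impI)
      fix e :: real assume e: "0 < e"
      let ?z = "Complex (real n) ((real n)\<^sup>2 - e / 2)"
      have "?z \<in> outside ?S" using out epi e by (auto dest!: subsetD)
      moreover have "dist ?z (?p n) < e"
        using e by (simp add: parabola_point_def dist_norm cmod_def)
      ultimately show "\<exists>y\<in>outside ?S. dist y (?p n) < e" by blast
    qed
    then show ?thesis using int by (simp add: frontier_def)
  qed
  then show ?thesis unfolding outerplanar_def using draw by blast
qed

section \<open>Two linked triangles: sharpness\<close>

lemma nonseparable_triangle:
  assumes d: "a \<noteq> b" "b \<noteq> c" "a \<noteq> c"
  shows "nonseparable {a, b, c} {{a, b}, {b, c}, {c, a}}" (is "nonseparable _ ?T")
proof -
  have ac: "{a, c} = {c, a}" by (rule insert_commute)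
  have "graph_connected {a, b, c} ?T"
    by (rule graph_connectedI[where c = c]) (auto intro: adj_rtrancl_edge simp: ac)
  moreover have "graph_connected ({a, b, c} - {a}) {e \<in> ?T. a \<notin> e}"
    by (rule graph_connectedI[where c = c]) (use d in \<open>auto intro: adj_rtrancl_edge\<close>)
  moreover have "graph_connected ({a, b, c} - {b}) {e \<in> ?T. b \<notin> e}"
    by (rule graph_connectedI[where c = c]) (use d in \<open>auto intro: adj_rtrancl_edge simp: ac\<close>)
  moreover have "graph_connected ({a, b, c} - {c}) {e \<in> ?T. c \<notin> e}"
    by (rule graph_connectedI[where c = b]) (use d in \<open>auto intro: adj_rtrancl_edge\<close>)
  ultimately show ?thesis unfolding nonseparable_def by blast
qed

lemma is_cycle_graph_triangle:
  assumes "a \<noteq> b" "b \<noteq> c" "a \<noteq> c"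
  shows "is_cycle_graph {a, b, c} {{a, b}, {b, c}, {c, a}}"
proof -
  have three: "{f i | i. i < (3::nat)} = {f 0, f 1, f 2}" for f :: "nat \<Rightarrow> 'b"
  proof -
    have "{f i | i. i < (3::nat)} = f ` {..<3}" by auto
    also have "{..<3} = {0, 1, 2::nat}" by auto
    finally show ?thesis by simp
  qed
  show ?thesis
    unfolding is_cycle_graph_def
  proof (intro exI[of _ "[a, b, c]"] conjI)
    have len: "length [a, b, c] = 3" by simp
    show "{{a, b}, {b, c}, {c, a}} =
        {{[a, b, c] ! i, [a, b, c] ! (Suc i mod length [a, b, c])} | i. i < length [a, b, c]}"
      unfolding len three by simp
  qed (use assms in auto)
qed
text \<open>The triangle is itself nonseparable, so by maximality a block contained in it is all of
  it.\<close>

lemma block_in_triangle: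
  assumes blk: "is_block B F V E" and d: "a \<noteq> b" "b \<noteq> c" "a \<noteq> c"
    and T: "{a, b, c} \<subseteq> V" "{{a, b}, {b, c}, {c, a}} \<subseteq> E"
    and B: "B \<subseteq> {a, b, c}" "F \<subseteq> {{a, b}, {b, c}, {c, a}}"
  shows "is_cycle_graph B F"
proof -
  have "subgraph {a, b, c} {{a, b}, {b, c}, {c, a}} V E"
    using T d by (simp add: subgraph_def simple_graph_def)
  from is_blockD(3)[OF blk this nonseparable_triangle[OF d] B] is_cycle_graph_triangle[OF d]
  show ?thesis by simp
qed

text \<open>The labels avoid interlacing edges along the parabola: each triangle has consecutive
  labels, and the bridge joins the last label of one to the first of the other.\<close>

definition linked_triangles :: "nat set set" where
  "linked_triangles = {{0, 1}, {1, 2}, {2, 0}, {3, 4}, {4, 5}, {5, 3}, {2, 3}}"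

lemma linked_triangles_iff:
  "{a, b} \<in> linked_triangles \<longleftrightarrow>
     (a, b) \<in> {(0, 1), (1, 2), (2, 0), (3, 4), (4, 5), (5, 3), (2, 3),
               (1, 0), (2, 1), (0, 2), (4, 3), (5, 4), (3, 5), (3, 2)}"
  by (auto simp: linked_triangles_def doubleton_eq_iff)

lemma simple_linked_triangles: "simple_graph {..5} linked_triangles"
  by (auto simp: simple_graph_def linked_triangles_def)

lemma outerplanar_linked_triangles: "outerplanar {..5} linked_triangles"
proof (rule outerplanar_noncrossing)
  \<comment> \<open>The edges with the smaller label first, so that both conditions become finite
    checks.\<close>
  let ?P = "{(0, 1), (1, 2), (0, 2), (3, 4), (4, 5), (3, 5), (2, 3)} :: (nat \<times> nat) set"
  have P: "(a, b) \<in> ?P" if ab: "{a, b} \<in> linked_triangles" "a < b" for a b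
    using ab unfolding linked_triangles_iff by auto
  have bound: "\<forall>(a, b)\<in>?P. a \<in> {..5} \<and> b \<in> {..5}" by simp
  have nc: "\<forall>(a, b)\<in>?P. \<forall>(c, d)\<in>?P. \<not> (a < c \<and> c < b \<and> b < d)" by simp
  show "\<exists>a b. a < b \<and> e = {a, b} \<and> a \<in> {..5} \<and> b \<in> {..5}" if e: "e \<in> linked_triangles" for e
  proof -
    obtain x y where xy: "e = {x, y}" "x \<noteq> y"
      using simple_graph_edgeD(2)[OF simple_linked_triangles e] by (meson card_2_iff)
    then have "e = {min x y, max x y}" "min x y < max x y" by (auto simp: min_def max_def)
    then obtain a b where ab: "e = {a, b}" "a < b" by blast
    then have "(a, b) \<in> ?P" using P e by simp
    from bspec[OF bound this] show ?thesis using ab by auto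
  qed
  show False if "{a, b} \<in> linked_triangles" "{c, d} \<in> linked_triangles" and lt: "a < c" "c < b" "b < d" for a b c d
  proof -
    have "a < b" "c < d" using lt by linarith+
    then have ab: "(a, b) \<in> ?P" and cd: "(c, d) \<in> ?P" using P that(1,2) by metis+
    from bspec[OF nc ab] have "\<forall>(c, d)\<in>?P. \<not> (a < c \<and> c < b \<and> b < d)" by (simp only: prod.case)
    from bspec[OF this cd] lt show False by simp
  qed
qed simp

text \<open>A block with the bridge is just the bridge, as deleting \<open>2\<close> or
  \<open>3\<close> would cut off any further vertex. A block without the bridge is connected, hence
  confined to one triangle, and so equals it.\<close>

lemma block_linked_triangles:
  assumes blk: "is_block B F {..5} linked_triangles" and "F \<noteq> {}"
  shows "is_edge_graph B F \<or> is_cycle_graph B F"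
proof -
  have B5: "B \<subseteq> {..5}" and FE: "F \<subseteq> linked_triangles" and sF: "simple_graph B F"
    using is_blockD(1)[OF blk] by (simp_all add: subgraph_def)
  have conn: "graph_connected B F" and connv: "\<And>v. v \<in> B \<Longrightarrow> graph_connected (B - {v}) {e \<in> F. v \<notin> e}"
    using is_blockD(2)[OF blk] by (simp_all add: nonseparable_def)
  have FB: "\<And>e. e \<in> F \<Longrightarrow> e \<subseteq> B" using simple_graph_edgeD(1)[OF sF] .
  \<comment> \<open>Deleting \<open>t\<close> leaves the block connected, so a set closed under the
    edges that avoid \<open>t\<close> cannot contain \<open>u\<close> and omit
    \<open>z\<close>.\<close>
  have cut: False
    if S: "u \<in> S" "u \<in> B" "z \<in> B" "z \<notin> S" "t \<in> B" "t \<notin> S" "z \<noteq> t"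
      and inv: "\<And>a b. {a, b} \<in> linked_triangles \<Longrightarrow> t \<noteq> a \<Longrightarrow> t \<noteq> b \<Longrightarrow> a \<in> S \<Longrightarrow> b \<in> S" for u z t S
  proof -
    have "(u, z) \<in> (adj {e \<in> F. t \<notin> e})\<^sup>*"
      by (rule graph_connectedD[OF connv[OF S(5)]]) (use S in auto)
    then have "z \<in> S" by (rule adj_rtrancl_invariant[OF _ S(1)]) (use inv FE in auto)
    then show False using S(4) by simp
  qed
  show ?thesis
  proof (cases "{2, 3} \<in> F")
    case True
    then have B: "2 \<in> B" "3 \<in> B" using FB by blast+
    have "u \<in> {2, 3}" if u: "u \<in> B" for u
    proof (rule ccontr)
      assume "u \<notin> {2, 3}"
      moreover have "u \<in> {0, 1, 2, 3, 4, 5}" using u B5 by auto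
      ultimately consider "u \<in> {0, 1}" | "u \<in> {4, 5}" by blast
      then show False
      proof cases
        case 1
        show False by (rule cut[OF 1 u B(2) _ B(1)]) (auto simp: linked_triangles_iff)
      next
        case 2
        show False by (rule cut[OF 2 u B(1) _ B(2)]) (auto simp: linked_triangles_iff)
      qed
    qed
    then have B23: "B = {2, 3}" using B by blast
    have "e = {2, 3}" if e: "e \<in> F" for e
      using simple_graph_edgeD[OF sF e] B23 card_subset_eq[of "{2, 3}" e] by simp
    then have "F = {{2, 3}}" using True by blast
    then have "is_edge_graph B F" unfolding is_edge_graph_def using B23 by (intro exI[of _ 2] exI[of _ 3]) simp
    then show ?thesis by simp
  next
    case False
    obtain e where e: "e \<in> F" using assms(2) by blast
    obtain a b where ab: "e = {a, b}" using simple_graph_edgeD(2)[OF sF e] by (meson card_2_iff)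
    have aB: "a \<in> B" using FB[OF e] ab by blast
    have BS: "B \<subseteq> S" if S: "a \<in> S"
      and inv: "\<And>a b. {a, b} \<in> linked_triangles \<Longrightarrow> {a, b} \<noteq> {2, 3} \<Longrightarrow> a \<in> S \<Longrightarrow> b \<in> S" for S
    proof
      fix u assume "u \<in> B"
      then have "(a, u) \<in> (adj F)\<^sup>*" using graph_connectedD[OF conn aB] by simp
      then show "u \<in> S"
      proof (rule adj_rtrancl_invariant[OF _ S])
        fix x y assume xy: "{x, y} \<in> F" "x \<in> S"
        have "{x, y} \<noteq> {2, 3}" using xy(1) False by metis
        then show "y \<in> S" using inv[OF subsetD[OF FE xy(1)] _ xy(2)] by simp
      qed
    qed
    have "a \<in> {0, 1, 2, 3, 4, 5}" using aB B5 by auto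
    then consider "a \<in> {0, 1, 2}" | "a \<in> {3, 4, 5}" by blast
    then have "is_cycle_graph B F"
    proof cases
      case 1
      have B: "B \<subseteq> {0, 1, 2}"
        by (rule BS[OF 1]) (unfold linked_triangles_iff, elim insertE emptyE; simp)
      have all: "\<forall>e\<in>linked_triangles. e \<subseteq> {0, 1, 2} \<longrightarrow> e \<in> {{0, 1}, {1, 2}, {2, 0}}"
        by (simp add: linked_triangles_def)
      have "F \<subseteq> {{0, 1}, {1, 2}, {2, 0}}"
        by (rule subsetI) (rule mp[OF bspec[OF all subsetD[OF FE]] order_trans[OF FB B]])
      then show ?thesis by (intro block_in_triangle[OF blk _ _ _ _ _ B]) (auto simp: linked_triangles_def)
    next
      case 2
      have B: "B \<subseteq> {3, 4, 5}"
        by (rule BS[OF 2]) (unfold linked_triangles_iff, elim insertE emptyE; simp add: insert_commute)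
      have all: "\<forall>e\<in>linked_triangles. e \<subseteq> {3, 4, 5} \<longrightarrow> e \<in> {{3, 4}, {4, 5}, {5, 3}}"
        by (simp add: linked_triangles_def)
      have "F \<subseteq> {{3, 4}, {4, 5}, {5, 3}}"
        by (rule subsetI) (rule mp[OF bspec[OF all subsetD[OF FE]] order_trans[OF FB B]])
      then show ?thesis by (intro block_in_triangle[OF blk _ _ _ _ _ B]) (auto simp: linked_triangles_def)
    qed
    then show ?thesis by simp
  qed
qed

lemma cactus_linked_triangles: "cactus {..5} linked_triangles"
  unfolding cactus_def
  using simple_linked_triangles outerplanar_linked_triangles block_linked_triangles by blast

text \<open>If all in-weights were at most \<open>2\<close>, those in each triangle would be \<open>0\<close>, \<open>1\<close>, \<open>2\<close>, adding up
  to \<open>6\<close> in total, less than the number of arcs.\<close>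

lemma linked_triangles_number_ge_3: "3 \<le> semi_proper_orientation_number {..5} linked_triangles"
  unfolding semi_proper_orientation_number_def
proof (rule INF_greatest, clarify)
  fix A w assume Aw: "semi_proper_orientation linked_triangles A w"
  have or: "bij_betw (\<lambda>(u, v). {u, v}) A linked_triangles"
    using Aw by (simp add: semi_proper_orientation_def orientation_def)
  have "card linked_triangles = 7" "finite linked_triangles"
    by (simp_all add: linked_triangles_def doubleton_eq_iff)
  then have cA: "card A = 7" and fA: "finite A"
    using bij_betw_same_card[OF or] bij_betw_finite[OF or] by simp_all
  have sub: "snd ` A \<subseteq> {..5}"
  proof
    fix y assume "y \<in> snd ` A"
    then obtain x where "(x, y) \<in> A" by auto
    then have "{x, y} \<in> linked_triangles" using bij_betwE[OF or] by fastforce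
    then show "y \<in> {..5}" by (auto simp: linked_triangles_iff)
  qed
  \<comment> \<open>Each arc is counted once, at its head; as weights are positive, the total is at
    least the number of arcs.\<close>
  have "(\<Sum>v\<in>{..5}. in_weight A w v) = sum w A"
    unfolding in_weight_def by (rule sum.group[OF fA _ sub]) simp
  moreover have "card A \<le> sum w A"
  proof -
    have "(\<Sum>a\<in>A. 1) \<le> sum w A"
      using Aw by (intro sum_mono) (auto simp: semi_proper_orientation_def Suc_le_eq)
    then show ?thesis by simp
  qed
  moreover have "{..5 :: nat} = {0, 1, 2, 3, 4, 5}" by auto
  ultimately have total: "7 \<le> in_weight A w 0 + in_weight A w 1 + in_weight A w 2 +
      (in_weight A w 3 + in_weight A w 4 + in_weight A w 5)"
    using cA by simp
  have ne: "in_weight A w a \<noteq> in_weight A w b" if "{a, b} \<in> linked_triangles" for a b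
    using Aw that by (simp add: semi_proper_orientation_def)
  have triangle: "x + y + z \<le> 3" if "x \<noteq> y" "y \<noteq> z" "z \<noteq> x" "x \<le> 2" "y \<le> 2" "z \<le> 2" for x y z :: nat
    using that by presburger
  have "3 \<le> max_in_weight {..5} A w"
  proof (rule ccontr)
    assume "\<not> 3 \<le> max_in_weight {..5} A w"
    moreover have "in_weight A w v \<le> max_in_weight {..5} A w" if "v \<le> 5" for v
      unfolding max_in_weight_def by (rule Max_ge) (use that in auto)
    ultimately have le: "in_weight A w v \<le> 2" if "v \<le> 5" for v
      using that by fastforce
    have "in_weight A w 0 + in_weight A w 1 + in_weight A w 2 \<le> 3"
      by (rule triangle) (simp_all add: le ne linked_triangles_def)
    moreover have "in_weight A w 3 + in_weight A w 4 + in_weight A w 5 \<le> 3"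
      by (rule triangle) (simp_all add: le ne linked_triangles_def)
    ultimately show False using total by linarith
  qed
  then show "3 \<le> enat (max_in_weight {..5} A w)" by (simp add: numeral_eq_enat)
qed

theorem theorem2:
  shows "(\<forall>(V :: 'a set) E. cactus V E \<longrightarrow> semi_proper_orientation_number V E \<le> 3) \<and>
         (\<exists>(V :: nat set) E. cactus V E \<and> semi_proper_orientation_number V E = 3)"
  using cactus_number_le_3 linked_triangles_number_ge_3 cactus_linked_triangles
  by (meson order_antisym)

end
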